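(* There is a universal constant $c$ (the constant in $\mathrm{O}(\ell)$, depending only on the fixed gate set) such that the following holds. For any quantum state $\rho_{XBC}$ that is classical on $X$ (with $B$, $C$ quantum), any $\varepsilon\ge 0$ and $s\in\mathbb{N}$, writing $\ell=\log\dim(C)$, $$H^{\varepsilon}_{\mathrm{unp}(s)}(X|BC)_{\rho}\;\ge\; H^{\varepsilon}_{\mathrm{unp}(s+\mathrm{O}(\ell))}(X|B)_{\rho}-2\ell .$$
   Context: All Hilbert spaces are finite-dimensional; $\log$ is base 2. A (sub-normalized) state is a positive semidefinite operator of trace at most $1$; normalized if the trace is $1$. A cq-state is $\rho_{XE}=\sum_x p_x|x\rangle\langle x|\otimes\rho_E^x$, with $\{|x\rangle\}$ the standard basis. Purified distance: for sub-normalized $\rho,\sigma$, $\Delta_P(\rho,\sigma)=\sqrt{1-F_*(\rho,\sigma)}$ with generalized fidelity $F_*(\rho,\sigma)=\big(\|\sqrt\rho\sqrt\sigma\|_1+\sqrt{(1-\mathrm{Tr}\rho)(1-\mathrm{Tr}\sigma)}\big)^2$. For $0\le\varepsilon<\sqrt{\mathrm{Tr}\rho}$, $\mathcal{B}_\varepsilon(\rho)$ is the set of sub-normalized $\tilde\rho$ on the same space with $\Delta_P(\rho,\tilde\rho)\le\varepsilon$. Circuits: fix a finite universal gate set whose gates act on at most two qubits, closed under inverses (e.g. Clifford$+$T); the Hadamard, NOT and CNOT gates each count as one gate. A circuit is a sequence of gates together with computational-basis measurements; ancillas in $|0\rangle$ are available; size is the number of gates, and computational-basis measurements are not counted. Quantum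 computational unpredictability entropy: for a cq-state $\rho_{XE}$, $\varepsilon\ge0$, $s\in\mathbb{N}$, one says $H^{\varepsilon}_{\mathrm{unp}(s)}(X|E)_\rho\ge k$ if there is a (possibly sub-normalized) cq-state $\tilde\rho_{XE}=\sum_x\tilde p_x|x\rangle\langle x|\otimes\tilde\rho^x_E\in\mathcal{B}_\varepsilon(\rho_{XE})$ such that every guessing circuit $\mathcal{C}$ of size at most $s$ satisfies $\Pr[\mathcal{C}(\tilde\rho^x_E)=x]:=\sum_x\tilde p_x\Pr[\mathcal{C}(\tilde\rho_E^x)=x]\le 2^{-k}$. The entropy is the supremum of such $k$. *)

theory Defs
  imports "Jordan_Normal_Form.Schur_Decomposition" "HOL-Library.Extended_Real"
begin

section \<open>Operators on finite-dimensional Hilbert spaces\<close>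

text \<open>
  Operators on a \<open>d\<close>-dimensional space are \<open>d \<times> d\<close> complex matrices in the standard basis
  \<open>0, \<dots>, d - 1\<close>. On a tensor product of spaces of dimensions \<open>d\<close> and \<open>e\<close>, the basis vector
  \<open>|i\<rangle> \<otimes> |j\<rangle>\<close> has index \<open>i * e + j\<close>.
\<close>

definition mtrace :: "complex mat \<Rightarrow> complex" where
  "mtrace A = (\<Sum>i<dim_row A. A $$ (i, i))"

text \<open>The order on complex numbers is such that \<open>0 \<le> z\<close> includes \<open>z\<close> being real.\<close>

definition psd :: "complex mat \<Rightarrow> bool" where
  "psd A \<longleftrightarrow> dim_col A = dim_row A \<and>
     (\<forall>v \<in> carrier_vec (dim_row A). 0 \<le> (A *\<^sub>v v) \<bullet>c v)"

definition psd_sqrt :: "complex mat \<Rightarrow> complex mat" where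
  "psd_sqrt A = (THE B. B \<in> carrier_mat (dim_row A) (dim_row A) \<and> psd B \<and> B * B = A)"

definition trace_norm :: "complex mat \<Rightarrow> real" where
  "trace_norm A = Re (mtrace (psd_sqrt (mat_adjoint A * A)))"

definition unitary_mat :: "nat \<Rightarrow> complex mat \<Rightarrow> bool" where
  "unitary_mat d U \<longleftrightarrow> U \<in> carrier_mat d d \<and>
     mat_adjoint U * U = 1\<^sub>m d \<and> U * mat_adjoint U = 1\<^sub>m d"

definition kron :: "complex mat \<Rightarrow> complex mat \<Rightarrow> complex mat" where
  "kron A B = mat (dim_row A * dim_row B) (dim_col A * dim_col B)
     (\<lambda>(i, j). A $$ (i div dim_row B, j div dim_col B) * B $$ (i mod dim_row B, j mod dim_col B))"

definition basis_proj :: "nat \<Rightarrow> nat \<Rightarrow> complex mat" where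
  "basis_proj d x = mat d d (\<lambda>(i, j). if i = x \<and> j = x then 1 else 0)"

text \<open>Trace over the second factor of a tensor product of dimensions \<open>d\<close> and \<open>e\<close>.\<close>

definition partial_trace :: "nat \<Rightarrow> nat \<Rightarrow> complex mat \<Rightarrow> complex mat" where
  "partial_trace d e A = mat d d (\<lambda>(i, j). \<Sum>c<e. A $$ (i * e + c, j * e + c))"

section \<open>States and the purified distance\<close>

definition substate :: "nat \<Rightarrow> complex mat \<Rightarrow> bool" where
  "substate d \<rho> \<longleftrightarrow> \<rho> \<in> carrier_mat d d \<and> psd \<rho> \<and> Re (mtrace \<rho>) \<le> 1"

definition normalized_state :: "nat \<Rightarrow> complex mat \<Rightarrow> bool" where
  "normalized_state d \<rho> \<longleftrightarrow> \<rho> \<in> carrier_mat d d \<and> psd \<rho> \<and> mtrace \<rho> = 1"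

text \<open>
  A sub-normalized cq-state is given by weights \<open>p x\<close> of total mass at most 1 and normalized
  conditional states \<open>r x\<close>.
\<close>

definition cq_ensemble :: "nat \<Rightarrow> nat \<Rightarrow> (nat \<Rightarrow> real) \<Rightarrow> (nat \<Rightarrow> complex mat) \<Rightarrow> bool" where
  "cq_ensemble dX dE p r \<longleftrightarrow>
     (\<forall>x<dX. 0 \<le> p x) \<and> (\<Sum>x<dX. p x) \<le> 1 \<and> (\<forall>x<dX. normalized_state dE (r x))"

definition cq_operator ::
  "nat \<Rightarrow> nat \<Rightarrow> (nat \<Rightarrow> real) \<Rightarrow> (nat \<Rightarrow> complex mat) \<Rightarrow> complex mat" where
  "cq_operator dX dE p r = mat (dX * dE) (dX * dE)
     (\<lambda>(i, j). \<Sum>x<dX. of_real (p x) * kron (basis_proj dX x) (r x) $$ (i, j))"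

definition cq_state :: "nat \<Rightarrow> nat \<Rightarrow> complex mat \<Rightarrow> bool" where
  "cq_state dX dE \<rho> \<longleftrightarrow> (\<exists>p r. cq_ensemble dX dE p r \<and> \<rho> = cq_operator dX dE p r)"

definition gen_fidelity :: "complex mat \<Rightarrow> complex mat \<Rightarrow> real" where
  "gen_fidelity \<rho> \<sigma> = (trace_norm (psd_sqrt \<rho> * psd_sqrt \<sigma>)
     + sqrt ((1 - Re (mtrace \<rho>)) * (1 - Re (mtrace \<sigma>))))\<^sup>2"

definition purified_dist :: "complex mat \<Rightarrow> complex mat \<Rightarrow> real" where
  "purified_dist \<rho> \<sigma> = sqrt (1 - gen_fidelity \<rho> \<sigma>)"

text \<open>
  The ball is used for every \<open>\<epsilon> \<ge> 0\<close>. Once \<open>\<epsilon>\<close> reaches the square root of the trace of \<open>\<rho>\<close> it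
  contains the zero operator.
\<close>

definition eps_ball :: "real \<Rightarrow> complex mat \<Rightarrow> complex mat set" where
  "eps_ball \<epsilon> \<rho> = {\<sigma>. substate (dim_row \<rho>) \<sigma> \<and> purified_dist \<rho> \<sigma> \<le> \<epsilon>}"

section \<open>Circuits\<close>

text \<open>
  The state space of \<open>n\<close> wires has dimension \<open>2 ^ n\<close>; in the basis state \<open>i\<close>, wire \<open>q\<close> carries the
  binary digit \<open>bit i q\<close>. A gate \<open>U\<close> on the list of wires \<open>qs\<close> is written in the usual order, with
  the first wire of \<open>qs\<close> as the most significant one (for CNOT, the control).
\<close>

definition sub_index :: "nat list \<Rightarrow> nat \<Rightarrow> nat" where
  "sub_index qs i = horner_sum of_bool 2 (map (bit i) (rev qs))"

definition lift_gate :: "nat \<Rightarrow> complex mat \<Rightarrow> nat list \<Rightarrow> complex mat" where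
  "lift_gate n U qs = mat (2 ^ n) (2 ^ n)
     (\<lambda>(i, j). if \<forall>q<n. q \<notin> set qs \<longrightarrow> bit i q = bit j q
               then U $$ (sub_index qs i, sub_index qs j) else 0)"

definition wire_proj :: "nat \<Rightarrow> nat \<Rightarrow> bool \<Rightarrow> complex mat" where
  "wire_proj n q b = mat (2 ^ n) (2 ^ n) (\<lambda>(i, j). if i = j \<and> bit i q = b then 1 else 0)"

definition hadamard_gate :: "complex mat" where
  "hadamard_gate = mat_of_rows_list 2
     [[1 / sqrt 2,   1 / sqrt 2],
      [1 / sqrt 2, - 1 / sqrt 2]]"

definition not_gate :: "complex mat" where
  "not_gate = mat_of_rows_list 2
     [[0, 1],
      [1, 0]]"

definition cnot_gate :: "complex mat" where
  "cnot_gate = mat_of_rows_list 4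
     [[1, 0, 0, 0],
      [0, 1, 0, 0],
      [0, 0, 0, 1],
      [0, 0, 1, 0]]"

definition gate_on :: "complex mat set \<Rightarrow> nat \<Rightarrow> complex mat \<Rightarrow> nat list \<Rightarrow> bool" where
  "gate_on G n U qs \<longleftrightarrow>
     U \<in> G \<and> dim_row U = 2 ^ length qs \<and> distinct qs \<and> set qs \<subseteq> {..<n}"

definition circuit_unitary :: "nat \<Rightarrow> (complex mat \<times> nat list) list \<Rightarrow> complex mat" where
  "circuit_unitary n gs = fold (\<lambda>(U, qs) M. lift_gate n U qs * M) gs (1\<^sub>m (2 ^ n))"

text \<open>
  Universality: on any number \<open>n \<ge> 2\<close> of qubits, every unitary is approximated arbitrarily well,
  up to a global phase, by products of gates.
\<close>

definition universal_gates :: "complex mat set \<Rightarrow> bool" where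
  "universal_gates G \<longleftrightarrow> (\<forall>n\<ge>2. \<forall>V. unitary_mat (2 ^ n) V \<longrightarrow> (\<forall>\<delta>>0. \<exists>gs \<theta>.
     (\<forall>(U, qs) \<in> set gs. gate_on G n U qs) \<and>
     (\<forall>i<2 ^ n. \<forall>j<2 ^ n. cmod (V $$ (i, j) - cis \<theta> * circuit_unitary n gs $$ (i, j)) < \<delta>)))"

definition universal_gate_set :: "complex mat set \<Rightarrow> bool" where
  "universal_gate_set G \<longleftrightarrow>
     finite G \<and>
     (\<forall>U\<in>G. unitary_mat 2 U \<or> unitary_mat 4 U) \<and>
     (\<forall>U\<in>G. mat_adjoint U \<in> G) \<and>
     {hadamard_gate, not_gate, cnot_gate} \<subseteq> G \<and>
     universal_gates G"

datatype instr = is_Gate: Gate "complex mat" "nat list" | Measure nat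

primrec wf_instr :: "complex mat set \<Rightarrow> nat \<Rightarrow> instr \<Rightarrow> bool" where
  "wf_instr G n (Gate U qs) \<longleftrightarrow> gate_on G n U qs"
| "wf_instr G n (Measure q) \<longleftrightarrow> q < n"

text \<open>
  \<open>run n is w \<sigma>\<close> is the unnormalized state after executing \<open>is\<close> on \<open>\<sigma>\<close> with measurement outcomes
  \<open>w\<close> (in chronological order); its trace is the probability of \<open>w\<close>.
\<close>

fun run :: "nat \<Rightarrow> instr list \<Rightarrow> bool list \<Rightarrow> complex mat \<Rightarrow> complex mat" where
  "run n [] [] \<sigma> = \<sigma>"
| "run n (Gate U qs # is) w \<sigma> = run n is w (lift_gate n U qs * \<sigma> * mat_adjoint (lift_gate n U qs))"
| "run n (Measure q # is) (b # w) \<sigma> = run n is w (wire_proj n q b * \<sigma> * wire_proj n q b)"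
| "run n _ _ \<sigma> = 0\<^sub>m (2 ^ n) (2 ^ n)"

text \<open>
  The entries of \<open>readout\<close> select the measurements of \<open>body\<close> (counted chronologically from 0) whose
  outcomes are the binary digits of the guess, least significant digit first.
\<close>

record circuit =
  num_wires :: nat
  body :: "instr list"
  readout :: "nat list"

definition circuit_size :: "circuit \<Rightarrow> nat" where
  "circuit_size C = length (filter is_Gate (body C))"

definition num_measurements :: "circuit \<Rightarrow> nat" where
  "num_measurements C = length (filter (Not \<circ> is_Gate) (body C))"

section \<open>Guessing from quantum side information\<close>

definition num_qubits :: "nat \<Rightarrow> nat" where
  "num_qubits d = nat \<lceil>log 2 (real d)\<rceil>"

text \<open>
  The side information is held in a list of registers of dimensions \<open>ds\<close>. A register of dimension
  \<open>d\<close> occupies \<open>num_qubits d\<close> consecutive wires, which carry the binary digits of the index of the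
  standard basis vector; for \<open>d\<close> a power of two this is just a qubit register. The wires above
  those of the registers are ancillas in state 0.
\<close>

definition register_wires :: "nat list \<Rightarrow> nat" where
  "register_wires ds = sum_list (map num_qubits ds)"

fun encode :: "nat list \<Rightarrow> nat \<Rightarrow> nat" where
  "encode [] i = 0"
| "encode (d # ds) i = i div prod_list ds + 2 ^ num_qubits d * encode ds (i mod prod_list ds)"

definition encode_isometry :: "nat \<Rightarrow> nat list \<Rightarrow> complex mat" where
  "encode_isometry n ds =
     mat (2 ^ n) (prod_list ds) (\<lambda>(k, i). if k = encode ds i then 1 else 0)"

definition load :: "nat \<Rightarrow> nat list \<Rightarrow> complex mat \<Rightarrow> complex mat" where
  "load n ds \<sigma> = encode_isometry n ds * \<sigma> * mat_adjoint (encode_isometry n ds)"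

definition guessing_circuit :: "complex mat set \<Rightarrow> nat \<Rightarrow> nat list \<Rightarrow> circuit \<Rightarrow> bool" where
  "guessing_circuit G dX ds C \<longleftrightarrow>
     register_wires ds \<le> num_wires C \<and>
     (\<forall>c \<in> set (body C). wf_instr G (num_wires C) c) \<and>
     length (readout C) = num_qubits dX \<and>
     set (readout C) \<subseteq> {..<num_measurements C}"

definition output_prob :: "circuit \<Rightarrow> nat list \<Rightarrow> complex mat \<Rightarrow> nat \<Rightarrow> real" where
  "output_prob C ds \<sigma> x =
     (\<Sum>w | length w = num_measurements C \<and> horner_sum of_bool 2 (map ((!) w) (readout C)) = x.
        Re (mtrace (run (num_wires C) (body C) w (load (num_wires C) ds \<sigma>))))"

text \<open>
  Here \<open>\<rho>\<close> lives on \<open>X \<otimes> E\<close> with \<open>X\<close> of dimension \<open>dX\<close> and \<open>E\<close> made of registers of dimensions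
  \<open>ds\<close>.
\<close>

definition unp_entropy_ge ::
  "complex mat set \<Rightarrow> real \<Rightarrow> nat \<Rightarrow> nat \<Rightarrow> nat list \<Rightarrow> complex mat \<Rightarrow> real \<Rightarrow> bool" where
  "unp_entropy_ge G \<epsilon> s dX ds \<rho> k \<longleftrightarrow>
     (\<exists>p r. cq_ensemble dX (prod_list ds) p r \<and>
            cq_operator dX (prod_list ds) p r \<in> eps_ball \<epsilon> \<rho> \<and>
            (\<forall>C. guessing_circuit G dX ds C \<and> circuit_size C \<le> s \<longrightarrow>
                 (\<Sum>x<dX. p x * output_prob C ds (r x) x) \<le> 2 powr (- k)))"

definition unp_entropy ::
  "complex mat set \<Rightarrow> real \<Rightarrow> nat \<Rightarrow> nat \<Rightarrow> nat list \<Rightarrow> complex mat \<Rightarrow> ereal" where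
  "unp_entropy G \<epsilon> s dX ds \<rho> = Sup {ereal k | k. unp_entropy_ge G \<epsilon> s dX ds \<rho> k}"

end

(* Let A be the square root of rho_XBC. Moving the C index from the rows of A to its columns gives a
   matrix A' whose Gram matrix is rho_XB. By polar decompositions, the nearby state of XB is a Gram
   matrix S S^* for which the overlap Tr(A'^* S) is the full fidelity. Moving the C index back turns S
   into a root of a state of XBC that extends the nearby one, and the overlap, hence the fidelity with
   rho_XBC, does not decrease. Removing the blocks that are off-diagonal in X preserves the overlap and
   makes the extension a cq-state.

   For guessing, rho_BC <= dim(C) (rho_B (x) 1). So a circuit that guesses from BC with probability q
   guesses with probability at least q / dim(C)^2 from rho_B and some standard basis state of C, and
   that state is written by at most one NOT gate per qubit of C. A basis state is used instead of the
   maximally mixed one since the latter cannot be prepared exactly when dim(C) is not a power of 2. *)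

theory Submission
  imports Defs "Jordan_Normal_Form.Spectral_Radius"
begin

subsection \<open>Adjoint and trace\<close>

text \<open>One nearby state of \<open>XBC\<close> has to serve all circuits at once, while the
  available bound on guessing refers to the given nearby state of \<open>XB\<close>. The extension
  must therefore be exact: the same weights \<open>p\<close>, and the conditional states
  \<open>r x\<close> after tracing out \<open>C\<close>. Exactness also keeps the trace, so the
  second summand of the generalized fidelity does not change and only trace norms have to be
  compared. Matrices with a prescribed Gram matrix stand in for purifications: tracing out
  \<open>C\<close> becomes a change of indices, and the number of columns stays free, which leaves
  room for the copies made when off-diagonal blocks are removed.

  Of the two factors dim(C) in the guessing bound, one is the constant of the operator inequality
  and the other counts the basis states over which the identity is expanded.

  \<open>psd_sqrt\<close> is a definite description and \<open>trace_norm\<close> rests on it, so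
  uniqueness of positive roots has to be settled first; existence then comes from the singular value
  decomposition.\<close>

lemma dim_mat_adjoint [simp]:
  "dim_row (mat_adjoint A) = dim_col A" "dim_col (mat_adjoint A) = dim_row A"
  by (auto simp: mat_adjoint_def)

lemma mat_adjoint_index [simp]:
  "i < dim_col A \<Longrightarrow> j < dim_row A \<Longrightarrow> mat_adjoint A $$ (i, j) = cnj (A $$ (j, i))"
  for A :: "complex mat"
  by (auto simp: mat_adjoint_def mat_of_rows_index)

lemma mat_adjoint_carrier:
  "A \<in> carrier_mat n m \<Longrightarrow> mat_adjoint A \<in> carrier_mat m n"
  by (rule carrier_matI) simp_all

lemma index_mult_mat_sum:
  "A \<in> carrier_mat n m \<Longrightarrow> B \<in> carrier_mat m k \<Longrightarrow> i < n \<Longrightarrow> j < k \<Longrightarrow>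
    (A * B) $$ (i, j) = (\<Sum>l<m. A $$ (i, l) * B $$ (l, j))"
  by (auto simp: scalar_prod_def atLeast0LessThan)

lemma mat_adjoint_adjoint [simp]: "mat_adjoint (mat_adjoint A) = A" for A :: "complex mat"
  by (rule eq_matI) auto

text \<open>The side conditions mention only the matrices themselves, so this form can serve as a
  rewrite rule; carrier hypotheses would bring in dimensions absent from the equation.\<close>

lemma assoc_mult_mat_dim:
  fixes A B C :: "'a :: semiring_0 mat"
  assumes "dim_col A = dim_row B" "dim_col B = dim_row C"
  shows "A * B * C = A * (B * C)"
  using assms by (intro assoc_mult_mat) auto

lemma mat_adjoint_mult:
  fixes A :: "complex mat"
  assumes "dim_col A = dim_row B"
  shows "mat_adjoint (A * B) = mat_adjoint B * mat_adjoint A"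
proof (rule eq_matI)
  fix i j assume "i < dim_row (mat_adjoint B * mat_adjoint A)" "j < dim_col (mat_adjoint B * mat_adjoint A)"
  with assms show "mat_adjoint (A * B) $$ (i, j) = (mat_adjoint B * mat_adjoint A) $$ (i, j)"
    by (auto simp: scalar_prod_def ac_simps)
qed (use assms in auto)

lemma mat_adjoint_one [simp]: "mat_adjoint (1\<^sub>m n :: complex mat) = 1\<^sub>m n"
  by (rule eq_matI) auto

lemma mtrace_mult_sum:
  assumes "A \<in> carrier_mat n m" "B \<in> carrier_mat m n"
  shows "mtrace (A * B) = (\<Sum>i<n. \<Sum>l<m. A $$ (i, l) * B $$ (l, i))"
  using assms by (auto simp: mtrace_def scalar_prod_def atLeast0LessThan)

lemma mtrace_comm:
  assumes "A \<in> carrier_mat n m" "B \<in> carrier_mat m n"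
  shows "mtrace (A * B) = mtrace (B * A)"
  unfolding mtrace_mult_sum[OF assms] mtrace_mult_sum[OF assms(2,1)]
  by (subst sum.swap) (simp add: ac_simps)

text \<open>This is the squared Frobenius norm. It shows that only the zero matrix has Gram matrix
  0, and later turns outcome probabilities into sums of squares.\<close>

lemma mtrace_gram:
  assumes "A \<in> carrier_mat n m"
  shows "mtrace (A * mat_adjoint A) = of_real (\<Sum>i<n. \<Sum>j<m. (cmod (A $$ (i, j)))\<^sup>2)"
proof -
  have "mat_adjoint A \<in> carrier_mat m n" using assms by auto
  from mtrace_mult_sum[OF assms this] show ?thesis
    using assms by (simp add: complex_norm_square[symmetric])
qed

subsection \<open>Positive semidefinite matrices\<close>

text \<open>\<open>f\<close> ranges over functions rather than vectors, so that restricting the form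
  to one block amounts to shifting the argument of \<open>f\<close>.\<close>

lemma psd_iff:
  assumes A: "A \<in> carrier_mat n n"
  shows "psd A \<longleftrightarrow> (\<forall>f. 0 \<le> (\<Sum>i<n. \<Sum>j<n. A $$ (i, j) * f j * cnj (f i)))"
proof -
  have *: "(A *\<^sub>v v) \<bullet>c v = (\<Sum>i<n. \<Sum>j<n. A $$ (i, j) * v $ j * cnj (v $ i))"
    if "v \<in> carrier_vec n" for v
    using that A by (auto simp: scalar_prod_def atLeast0LessThan sum_distrib_right)
  show ?thesis
  proof
    assume p: "psd A"
    show "\<forall>f. 0 \<le> (\<Sum>i<n. \<Sum>j<n. A $$ (i, j) * f j * cnj (f i))"
    proof
      fix f
      have "0 \<le> (A *\<^sub>v vec n f) \<bullet>c vec n f"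
        using p A by (auto simp: psd_def)
      then show "0 \<le> (\<Sum>i<n. \<Sum>j<n. A $$ (i, j) * f j * cnj (f i))"
        by (subst (asm) *) auto
    qed
  next
    assume r: "\<forall>f. 0 \<le> (\<Sum>i<n. \<Sum>j<n. A $$ (i, j) * f j * cnj (f i))"
    show "psd A"
      unfolding psd_def using A r by (auto simp only: * carrier_matD)
  qed
qed

lemma sum_two:
  fixes a b :: "'a :: semiring_1" and i j n :: nat
  assumes "i < n" "j < n" "i \<noteq> j"
  shows "(\<Sum>k<n. h k * (if k = i then a else if k = j then b else 0)) = h i * a + h j * b"
proof -
  have "(\<Sum>k<n. h k * (if k = i then a else if k = j then b else 0))
     = (\<Sum>k\<in>{i, j}. h k * (if k = i then a else if k = j then b else 0))"
    by (rule sum.mono_neutral_right) (use assms in auto)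
  with assms(3) show ?thesis by simp
qed

text \<open>The form is tested on the vector with entries \<open>a\<close> and \<open>b\<close> at
  \<open>i\<close> and \<open>j\<close>. Suitable values control the off-diagonal entries in the
  lemmas on hermiticity and on trace 0.\<close>

lemma psd_two:
  assumes A: "A \<in> carrier_mat n n" and "psd A" and ij: "i < n" "j < n" "i \<noteq> j"
  shows "0 \<le> (A $$ (i, i) * a + A $$ (i, j) * b) * cnj a + (A $$ (j, i) * a + A $$ (j, j) * b) * cnj b"
proof -
  let ?f = "\<lambda>k. if k = i then a else if k = j then b else 0"
  have "0 \<le> (\<Sum>k<n. \<Sum>l<n. A $$ (k, l) * ?f l * cnj (?f k))"
    using assms(2) unfolding psd_iff[OF A] by (rule spec)
  also have "\<dots> = (\<Sum>k<n. (\<Sum>l<n. A $$ (k, l) * ?f l) * (if k = i then cnj a else if k = j then cnj b else 0))"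
    unfolding sum_distrib_right by (intro sum.cong) auto
  also have "\<dots> = (A $$ (i, i) * a + A $$ (i, j) * b) * cnj a + (A $$ (j, i) * a + A $$ (j, j) * b) * cnj b"
    unfolding sum_two[OF ij] by simp
  finally show ?thesis .
qed

lemma psd_diag:
  assumes A: "A \<in> carrier_mat n n" and "psd A" and i: "i < n"
  shows "0 \<le> A $$ (i, i)"
proof -
  let ?f = "\<lambda>k. if k = i then 1 else 0"
  have "0 \<le> (\<Sum>k<n. \<Sum>l<n. A $$ (k, l) * ?f l * cnj (?f k))"
    using assms(2) unfolding psd_iff[OF A] by (rule spec)
  also have "\<dots> = (\<Sum>k<n. if k = i then (\<Sum>l<n. if l = i then A $$ (k, l) else 0) else 0)"
    by (intro sum.cong refl) (simp add: if_distrib[of "\<lambda>x. _ * x"] cong: if_cong)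
  also have "\<dots> = A $$ (i, i)" using i by simp
  finally show ?thesis .
qed

lemma psd_hermitian:
  assumes A: "A \<in> carrier_mat n n" and "psd A"
  shows "mat_adjoint A = A"
proof (rule eq_matI)
  fix i j assume "i < dim_row A" "j < dim_col A"
  with A have ij: "i < n" "j < n" by auto
  have d: "Im (A $$ (k, k)) = 0" if "k < n" for k
    using psd_diag[OF A assms(2) that] by (simp add: less_eq_complex_def)
  have "cnj (A $$ (j, i)) = A $$ (i, j)"
  proof (cases "i = j")
    case True then show ?thesis using d ij by (simp add: complex_eq_iff)
  next
    case False
    note p = psd_two[OF A assms(2) ij False]
    \<comment> \<open>The vector \<open>(1, 1)\<close> makes the imaginary parts of the two
      off-diagonal entries opposite, the vector \<open>(1, \<i>)\<close> makes their real parts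
      equal.\<close>
    show ?thesis using p[of 1 1] p[of 1 \<i>] d[OF ij(1)] d[OF ij(2)]
      by (auto simp: less_eq_complex_def complex_eq_iff)
  qed
  then show "mat_adjoint A $$ (i, j) = A $$ (i, j)" using A ij by simp
qed (use A in auto)

lemma psd_trace_nonneg:
  assumes A: "A \<in> carrier_mat n n" and "psd A"
  shows "0 \<le> mtrace A"
  using A psd_diag[OF assms] by (auto simp: mtrace_def intro!: sum_nonneg)

lemma psd_trace_zero:
  assumes A: "A \<in> carrier_mat n n" and p: "psd A" and t: "mtrace A = 0"
  shows "A = 0\<^sub>m n n"
proof -
  have d: "A $$ (i, i) = 0" if "i < n" for i
  proof -
    have "(\<Sum>i<n. A $$ (i, i)) = 0" using t A by (simp add: mtrace_def)
    moreover have "\<forall>i\<in>{..<n}. 0 \<le> A $$ (i, i)" using psd_diag[OF A p] by auto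
    ultimately show ?thesis using that sum_nonneg_eq_0_iff[of "{..<n}" "\<lambda>i. A $$ (i, i)"] by auto
  qed
  show ?thesis
  proof (rule eq_matI)
    fix i j assume "i < dim_row (0\<^sub>m n n :: complex mat)" "j < dim_col (0\<^sub>m n n :: complex mat)"
    then have ij: "i < n" "j < n" by auto
    have h: "A $$ (j, i) = cnj (A $$ (i, j))"
      using arg_cong[OF psd_hermitian[OF A p], of "\<lambda>X. X $$ (j, i)"] A ij by simp
    show "A $$ (i, j) = 0\<^sub>m n n $$ (i, j)"
    proof (cases "i = j")
      case False
      \<comment> \<open>As the diagonal is 0, the form at this vector is -2 times the squared
        modulus of the entry.\<close>
      from psd_two[OF A p ij False, of "- A $$ (i, j)" 1]
      have "0 \<le> - 2 * (A $$ (i, j) * cnj (A $$ (i, j)))"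
        using ij d h by (simp add: algebra_simps)
      then have "(cmod (A $$ (i, j)))\<^sup>2 \<le> 0"
        by (simp add: complex_norm_square[symmetric] less_eq_complex_def)
      with ij show ?thesis by simp
    qed (use d ij in auto)
  qed (use A in auto)
qed

lemma psd_gram:
  assumes B: "B \<in> carrier_mat n m"
  shows "psd (B * mat_adjoint B)"
proof -
  have c: "B * mat_adjoint B \<in> carrier_mat n n" using B by auto
  show ?thesis unfolding psd_iff[OF c]
  proof
    fix f
    have "(\<Sum>i<n. \<Sum>j<n. (B * mat_adjoint B) $$ (i, j) * f j * cnj (f i))
      = (\<Sum>i<n. \<Sum>j<n. \<Sum>k<m. (B $$ (i, k) * cnj (f i)) * cnj (B $$ (j, k) * cnj (f j)))"
      using B by (intro sum.cong) (auto simp: scalar_prod_def atLeast0LessThan sum_distrib_left ac_simps)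
    also have "\<dots> = (\<Sum>k<m. \<Sum>i<n. \<Sum>j<n. (B $$ (i, k) * cnj (f i)) * cnj (B $$ (j, k) * cnj (f j)))"
      by (subst sum.swap[of _ _ "{..<m}"], subst sum.swap[of _ "{..<m}"]) simp
    also have "\<dots> = (\<Sum>k<m. (\<Sum>i<n. B $$ (i, k) * cnj (f i)) * cnj (\<Sum>i<n. B $$ (i, k) * cnj (f i)))"
      by (simp only: cnj_sum sum_product)
    also have "\<dots> \<ge> 0"
      by (intro sum_nonneg) (simp only: complex_norm_square[symmetric], simp add: less_eq_complex_def)
    finally show "0 \<le> (\<Sum>i<n. \<Sum>j<n. (B * mat_adjoint B) $$ (i, j) * f j * cnj (f i))" .
  qed
qed

lemma mat_adjoint_scalar_prod:
  fixes K :: "complex mat"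
  assumes "K \<in> carrier_mat m n" "x \<in> carrier_vec n" "y \<in> carrier_vec m"
  shows "(K *\<^sub>v x) \<bullet>c y = x \<bullet>c (mat_adjoint K *\<^sub>v y)"
proof -
  have "(K *\<^sub>v x) \<bullet>c y = (\<Sum>i<m. \<Sum>j<n. K $$ (i, j) * x $ j * cnj (y $ i))"
    using assms by (auto simp: scalar_prod_def atLeast0LessThan sum_distrib_right)
  also have "\<dots> = (\<Sum>j<n. \<Sum>i<m. K $$ (i, j) * x $ j * cnj (y $ i))" by (rule sum.swap)
  also have "\<dots> = x \<bullet>c (mat_adjoint K *\<^sub>v y)"
    using assms by (auto simp: scalar_prod_def atLeast0LessThan sum_distrib_left ac_simps)
  finally show ?thesis .
qed

lemma psd_congruence:
  assumes K: "K \<in> carrier_mat m n" and A: "A \<in> carrier_mat n n" and p: "psd A"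
  shows "psd (K * A * mat_adjoint K)"
proof -
  have c: "K * A * mat_adjoint K \<in> carrier_mat m m" using K A by auto
  show ?thesis unfolding psd_def
  proof (intro conjI ballI)
    fix v :: "complex vec" assume "v \<in> carrier_vec (dim_row (K * A * mat_adjoint K))"
    then have v: "v \<in> carrier_vec m" using K by auto
    let ?w = "mat_adjoint K *\<^sub>v v"
    have w: "?w \<in> carrier_vec n" by (rule mult_mat_vec_carrier[OF mat_adjoint_carrier[OF K] v])
    have Aw: "A *\<^sub>v ?w \<in> carrier_vec n" using A w by auto
    have "(K * A * mat_adjoint K) *\<^sub>v v = K *\<^sub>v (A *\<^sub>v ?w)"
    proof -
      have KA: "K * A \<in> carrier_mat m n" and K': "mat_adjoint K \<in> carrier_mat n m" using K A by auto
      show ?thesis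
        unfolding assoc_mult_mat_vec[OF KA K' v] assoc_mult_mat_vec[OF K A w] ..
    qed
    then have "((K * A * mat_adjoint K) *\<^sub>v v) \<bullet>c v = (A *\<^sub>v ?w) \<bullet>c ?w"
      using mat_adjoint_scalar_prod[OF K Aw v] by simp
    also have "\<dots> \<ge> 0" using p A w by (auto simp: psd_def)
    finally show "0 \<le> ((K * A * mat_adjoint K) *\<^sub>v v) \<bullet>c v" .
  qed (use c in auto)
qed

text \<open>With \<open>D = B - C\<close>, the equation \<open>B * B = C * C\<close> reads \<open>B * D + D * C = 0\<close>. Hence the positive
  matrices \<open>D * B * D\<close> and \<open>D * C * D\<close> have traces adding up to \<open>0\<close>, so both vanish, and so does
  their difference \<open>D * D * D\<close>.\<close>

lemma psd_sqrt_unique: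
  assumes B: "B \<in> carrier_mat n n" and C: "C \<in> carrier_mat n n"
    and pB: "psd B" and pC: "psd C" and eq: "B * B = C * C"
  shows "B = C"
proof -
  define D where "D = B - C"
  have D: "D \<in> carrier_mat n n" using B C by (auto simp: D_def)
  have hD: "mat_adjoint D = D"
  proof (rule eq_matI)
    fix i j assume "i < dim_row D" "j < dim_col D"
    then have ij: "i < n" "j < n" using D by auto
    have "cnj (X $$ (j, i)) = X $$ (i, j)" if "X \<in> carrier_mat n n" "psd X" for X
      using arg_cong[OF psd_hermitian[OF that], of "\<lambda>X. X $$ (i, j)"] that(1) ij by simp
    from this[OF B pB] this[OF C pC] show "mat_adjoint D $$ (i, j) = D $$ (i, j)"
      using B C ij by (simp add: D_def)
  qed (use D in auto)
  have z: "B * D + D * C = 0\<^sub>m n n"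
  proof -
    have "B * D + D * C = (B * B - B * C) + (B * C - C * C)"
      unfolding D_def using B C
      by (simp add: mult_minus_distrib_mat[of _ n n _ n] minus_mult_distrib_mat[of _ n n _ _ n])
    also have "\<dots> = 0\<^sub>m n n" using B C unfolding eq by (intro eq_matI) auto
    finally show ?thesis .
  qed
  have pDB: "psd (D * B * D)" using psd_congruence[OF D B pB] hD by simp
  have pDC: "psd (D * C * D)" using psd_congruence[OF D C pC] hD by simp
  have cDB: "D * B * D \<in> carrier_mat n n" and cDC: "D * C * D \<in> carrier_mat n n"
    using B C D by auto
  have "mtrace (D * (B * D)) + mtrace (D * (D * C)) = mtrace (D * (B * D + D * C))"
  proof -
    have "D * (B * D + D * C) = D * (B * D) + D * (D * C)"
      using B C D by (simp add: mult_add_distrib_mat[of _ n n _ n])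
    then show ?thesis using B C D by (simp add: mtrace_def sum.distrib)
  qed
  also have "\<dots> = 0" using D unfolding z by (simp add: mtrace_def)
  also have "mtrace (D * (D * C)) = mtrace (D * C * D)"
    using C D by (intro mtrace_comm) auto
  finally have s: "mtrace (D * B * D) + mtrace (D * C * D) = 0"
    using B D by (simp add: assoc_mult_mat_dim)
  have n1: "0 \<le> mtrace (D * B * D)" by (rule psd_trace_nonneg[OF cDB pDB])
  have n2: "0 \<le> mtrace (D * C * D)" by (rule psd_trace_nonneg[OF cDC pDC])
  have z1: "D * B * D = 0\<^sub>m n n" and z2: "D * C * D = 0\<^sub>m n n"
    using psd_trace_zero[OF cDB pDB] psd_trace_zero[OF cDC pDC] s n1 n2
      add_nonneg_eq_0_iff[OF n1 n2] by auto
  \<comment> \<open>This leads from \<open>D * D * D = 0\<close> to \<open>D = 0\<close>: both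
    \<open>D * D\<close> and \<open>D\<close> are hermitian, so their squares are Gram matrices, and
    the fact applies first to \<open>D * D\<close> and then to \<open>D\<close>.\<close>
  have gram0: "X = 0\<^sub>m n n" if X: "X \<in> carrier_mat n n" and "X * mat_adjoint X = 0\<^sub>m n n" for X :: "complex mat"
  proof -
    have "mtrace (X * mat_adjoint X) = 0" using that(2) by (simp add: mtrace_def)
    then have "(\<Sum>i<n. \<Sum>j<n. (cmod (X $$ (i, j)))\<^sup>2) = 0"
      unfolding mtrace_gram[OF X] of_real_eq_0_iff .
    then have "\<forall>i<n. \<forall>j<n. X $$ (i, j) = 0"
      by (simp add: sum_nonneg_eq_0_iff sum_nonneg)
    with X show ?thesis by (intro eq_matI) auto
  qed
  have "D * D * D = D * B * D - D * C * D"
  proof -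
    have "D * D * D = D * (B - C) * D" by (simp add: D_def)
    also have "\<dots> = D * B * D - D * C * D"
      using B C D by (simp add: mult_minus_distrib_mat[of _ n n _ n] minus_mult_distrib_mat[of _ n n _ _ n])
    finally show ?thesis .
  qed
  then have D3: "D * D * D = 0\<^sub>m n n" unfolding z1 z2 by (intro eq_matI) auto
  have DD: "D * D \<in> carrier_mat n n" using D by auto
  have "mat_adjoint (D * D) = D * D" using mat_adjoint_mult[of D D] hD D by simp
  moreover have "D * D * (D * D) = 0\<^sub>m n n"
  proof -
    have "D * D * (D * D) = D * D * D * D" by (rule assoc_mult_mat[OF DD D D, symmetric])
    then show ?thesis unfolding D3 using D by simp
  qed
  ultimately have "D * D = 0\<^sub>m n n" using gram0[OF DD] by simp
  then have "D = 0\<^sub>m n n" using gram0[OF D] hD by simp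
  then have "B - C = 0\<^sub>m n n" by (simp add: D_def)
  show ?thesis
  proof (rule eq_matI)
    fix i j assume "i < dim_row C" "j < dim_col C"
    with C have ij: "i < n" "j < n" by auto
    have "(B - C) $$ (i, j) = 0" using \<open>B - C = 0\<^sub>m n n\<close> ij by simp
    then show "B $$ (i, j) = C $$ (i, j)" using ij B C by simp
  qed (use B C in auto)
qed

lemma psd_sqrt_eqI:
  assumes "B \<in> carrier_mat n n" "psd B" "B * B = A"
  shows "psd_sqrt A = B"
  unfolding psd_sqrt_def
proof (rule the_equality)
  have dA: "dim_row A = n" using assms by auto
  show "B \<in> carrier_mat (dim_row A) (dim_row A) \<and> psd B \<and> B * B = A" using assms dA by simp
  fix C assume "C \<in> carrier_mat (dim_row A) (dim_row A) \<and> psd C \<and> C * C = A"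
  then show "C = B" using psd_sqrt_unique[of C n B] assms dA by simp
qed

subsection \<open>Singular value decomposition\<close>

lemma unitary_mat_mult:
  assumes U: "unitary_mat n U" and V: "unitary_mat n V"
  shows "unitary_mat n (U * V)"
proof -
  have c: "U \<in> carrier_mat n n" "V \<in> carrier_mat n n"
    "mat_adjoint U \<in> carrier_mat n n" "mat_adjoint V \<in> carrier_mat n n"
    using assms by (auto simp: unitary_mat_def)
  have "mat_adjoint (U * V) * (U * V) = mat_adjoint V * (mat_adjoint U * U) * V"
    using c by (simp add: mat_adjoint_mult assoc_mult_mat_dim)
  moreover have "U * V * mat_adjoint (U * V) = U * (V * mat_adjoint V) * mat_adjoint U"
    using c by (simp add: mat_adjoint_mult assoc_mult_mat_dim)
  ultimately show ?thesis using assms c by (auto simp: unitary_mat_def)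
qed

lemma unitary_matI:
  assumes U: "U \<in> carrier_mat n n" and "mat_adjoint U * U = 1\<^sub>m n"
  shows "unitary_mat n U"
  using assms mat_mult_left_right_inverse[OF mat_adjoint_carrier[OF U] U] by (auto simp: unitary_mat_def)

lemma unitary_mat_adjoint: "unitary_mat n U \<Longrightarrow> unitary_mat n (mat_adjoint U)"
  by (auto simp: unitary_mat_def)

text \<open>Gram-Schmidt keeps the first vector of a basis that starts with \<open>v\<close>. It
  yields orthogonal vectors of arbitrary length, so the columns are scaled by \<open>c\<close>
  afterwards; the scaling does not touch \<open>v\<close>, which has length 1 already.\<close>

lemma unit_vector_extends_to_unitary:
  fixes v :: "complex vec"
  assumes v: "v \<in> carrier_vec n" and unit: "v \<bullet>c v = 1"
  shows "\<exists>U. unitary_mat n U \<and> col U 0 = v"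
proof -
  interpret cof_vec_space n "TYPE(complex)" .
  have v0: "v \<noteq> 0\<^sub>v n" using unit v by auto
  have n: "n \<noteq> 0" using v v0 by (cases "n = 0") auto
  define ws where "ws = gram_schmidt n (basis_completion v)"
  note bc = basis_completion[OF v v0]
  obtain vs where bv: "basis_completion v = v # vs" using bc(6,7) n by (cases "basis_completion v") auto
  have ws: "corthogonal ws" "set ws \<subseteq> carrier_vec n" "length ws = n"
    using gram_schmidt_result[OF bc(2,4,5) ws_def] bc(6) by auto
  have ws0: "ws ! 0 = v"
    using gram_schmidt_hd[OF v, of vs] ws(3) n unfolding bv[symmetric] ws_def[symmetric]
    by (cases ws) auto
  have wsc: "ws ! i \<in> carrier_vec n" if "i < n" for i using ws that by auto
  define c where "c i = 1 / sqrt (Re (ws ! i \<bullet>c ws ! i))" for i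
  define U where "U = mat n n (\<lambda>(i, j). of_real (c j) * ws ! j $ i)"
  have U: "U \<in> carrier_mat n n" by (simp add: U_def)
  have "mat_adjoint U * U = 1\<^sub>m n"
  proof (rule eq_matI)
    fix i j assume "i < dim_row (1\<^sub>m n :: complex mat)" "j < dim_col (1\<^sub>m n :: complex mat)"
    then have ij: "i < n" "j < n" by auto
    have "(mat_adjoint U * U) $$ (i, j) = of_real (c i) * of_real (c j) * (ws ! j \<bullet>c ws ! i)"
      using ij wsc[OF ij(1)] wsc[OF ij(2)] U
      by (auto simp: scalar_prod_def U_def sum_distrib_left ac_simps)
    also have "\<dots> = (if i = j then 1 else 0)"
    proof (cases "i = j")
      case True
      have "ws ! i \<bullet>c ws ! i \<noteq> 0" using corthogonalD[OF ws(1)] ij ws(3) by auto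
      moreover have "0 \<le> ws ! i \<bullet>c ws ! i" by auto
      ultimately obtain r where r: "ws ! i \<bullet>c ws ! i = of_real r" "0 < r"
        by (metis complex_is_Real_iff less_eq_complex_def Re_complex_of_real of_real_0 complex_eq_iff
            Im_complex_of_real zero_complex.sel order_le_less)
      then have "c i * c i * r = 1" by (simp add: c_def)
      then have "complex_of_real (c i * c i * r) = 1" by (simp only: of_real_1)
      with r True show ?thesis by simp
    qed (use corthogonalD[OF ws(1)] ij ws(3) in auto)
    finally show "(mat_adjoint U * U) $$ (i, j) = 1\<^sub>m n $$ (i, j)" using ij by simp
  qed (use U in auto)
  then have "unitary_mat n U" by (rule unitary_matI[OF U])
  moreover have "col U 0 = v"
    using n v unit by (intro eq_vecI) (auto simp: U_def c_def ws0)
  ultimately show ?thesis by blast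
qed

lemma normalize_vec:
  fixes v :: "complex vec"
  assumes v: "v \<in> carrier_vec n" and v0: "v \<noteq> 0\<^sub>v n"
  obtains c :: real where "0 < c" "(of_real c \<cdot>\<^sub>v v) \<bullet>c (of_real c \<cdot>\<^sub>v v) = 1" "v \<bullet>c v = of_real ((1 / c)\<^sup>2)"
proof -
  have "v \<bullet>c v > 0" using v v0 by auto
  then obtain r where r: "v \<bullet>c v = of_real r" "0 < r"
    by (metis complex_eq_iff less_complex_def Re_complex_of_real Im_complex_of_real zero_complex.sel)
  define c where "c = 1 / sqrt r"
  have "c * c * r = 1" using r by (simp add: c_def)
  then have "complex_of_real (c * c * r) = 1" by (simp only: of_real_1)
  then have "(of_real c \<cdot>\<^sub>v v) \<bullet>c (of_real c \<cdot>\<^sub>v v) = 1"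
    using v r by (simp add: conjugate_smult_vec mult.assoc[symmetric])
  moreover have "v \<bullet>c v = of_real ((1 / c)\<^sup>2)" "0 < c" using r by (auto simp: c_def)
  ultimately show thesis using that by blast
qed

text \<open>For singular \<open>M\<close>, kernel vectors of \<open>M\<close> and of its adjoint do
  with \<open>s = 0\<close>. Otherwise \<open>w\<close> is a unit eigenvector of
  \<open>mat_adjoint M * M\<close>, and \<open>v\<close> is its image scaled to length 1, which is
  possible because an invertible \<open>M\<close> does not annihilate \<open>w\<close>.\<close>

lemma singular_pair:
  fixes M :: "complex mat"
  assumes M: "M \<in> carrier_mat n n" and n: "0 < n"
  obtains v w s where "v \<in> carrier_vec n" "w \<in> carrier_vec n" "v \<bullet>c v = 1" "w \<bullet>c w = 1" "0 \<le> (s :: real)"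
    "M *\<^sub>v w = of_real s \<cdot>\<^sub>v v" "mat_adjoint M *\<^sub>v v = of_real s \<cdot>\<^sub>v w"
proof (cases "det M = 0")
  case True
  have M': "mat_adjoint M \<in> carrier_mat n n" using M by auto
  obtain w where w: "w \<in> carrier_vec n" "w \<noteq> 0\<^sub>v n" "M *\<^sub>v w = 0\<^sub>v n"
    using True det_0_iff_vec_prod_zero[OF M] by auto
  have "det (transpose_mat M) = 0" using True det_transpose[OF M] by simp
  then obtain u where u: "u \<in> carrier_vec n" "u \<noteq> 0\<^sub>v n" "transpose_mat M *\<^sub>v u = 0\<^sub>v n"
    using det_0_iff_vec_prod_zero[of "transpose_mat M" n] M by auto
  \<comment> \<open>The adjoint is the conjugate of the transpose, so conjugating a kernel vector of
    the transpose gives one of the adjoint.\<close>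
  define v where "v = conjugate u"
  have v: "v \<in> carrier_vec n" "v \<noteq> 0\<^sub>v n" using u by (auto simp: v_def)
  have "mat_adjoint M *\<^sub>v v = conjugate (transpose_mat M *\<^sub>v u)"
    using M u(1) by (intro eq_vecI) (auto simp: v_def scalar_prod_def)
  then have Mv: "mat_adjoint M *\<^sub>v v = 0\<^sub>v n" using u by simp
  obtain c where c: "(of_real c \<cdot>\<^sub>v v) \<bullet>c (of_real c \<cdot>\<^sub>v v) = 1" by (rule normalize_vec[OF v])
  obtain d where d: "(of_real d \<cdot>\<^sub>v w) \<bullet>c (of_real d \<cdot>\<^sub>v w) = 1" by (rule normalize_vec[OF w(1,2)])
  show thesis
    by (rule that[of "of_real c \<cdot>\<^sub>v v" "of_real d \<cdot>\<^sub>v w" 0])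
      (use v w c d Mv mult_mat_vec[OF M w(1)] mult_mat_vec[OF M' v(1)] in auto)
next
  case False
  have M': "mat_adjoint M \<in> carrier_mat n n" using M by auto
  have MM: "mat_adjoint M * M \<in> carrier_mat n n" using M by auto
  obtain e w0 where "eigenvector (mat_adjoint M * M) w0 e"
    using spectrum_non_empty[OF MM n] unfolding spectrum_def eigenvalue_def by auto
  then have w0: "w0 \<in> carrier_vec n" "w0 \<noteq> 0\<^sub>v n" "(mat_adjoint M * M) *\<^sub>v w0 = e \<cdot>\<^sub>v w0"
    using MM M by (auto simp: eigenvector_def)
  obtain c where c: "0 < c" "(of_real c \<cdot>\<^sub>v w0) \<bullet>c (of_real c \<cdot>\<^sub>v w0) = 1" by (rule normalize_vec[OF w0(1,2)])
  define w where "w = of_real c \<cdot>\<^sub>v w0"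
  have w: "w \<in> carrier_vec n" "w \<bullet>c w = 1" using w0 c by (auto simp: w_def)
  then have wn: "w \<noteq> 0\<^sub>v n" by auto
  define u where "u = M *\<^sub>v w"
  have u: "u \<in> carrier_vec n" using M w by (auto simp: u_def)
  have u0: "u \<noteq> 0\<^sub>v n" using False w wn det_0_iff_vec_prod_zero[OF M] by (auto simp: u_def)
  have "mat_adjoint M *\<^sub>v u = (mat_adjoint M * M) *\<^sub>v w"
    unfolding u_def using assoc_mult_mat_vec[OF M' M w(1)] by simp
  also have "\<dots> = e \<cdot>\<^sub>v w"
    unfolding w_def mult_mat_vec[OF MM w0(1)] w0(3) by (simp add: smult_smult_assoc mult.commute)
  finally have M'u: "mat_adjoint M *\<^sub>v u = e \<cdot>\<^sub>v w" .
  \<comment> \<open>The eigenvalue turns out to be a squared length, hence real and positive. Its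
    root \<open>1 / d\<close> is the singular value.\<close>
  have "u \<bullet>c u = w \<bullet>c (e \<cdot>\<^sub>v w)"
    using mat_adjoint_scalar_prod[OF M w(1) u] by (simp add: u_def[symmetric] M'u)
  also have "\<dots> = cnj e"
    using w by (simp add: conjugate_smult_vec)
  finally have ue: "u \<bullet>c u = cnj e" .
  obtain d where d: "0 < d" "(of_real d \<cdot>\<^sub>v u) \<bullet>c (of_real d \<cdot>\<^sub>v u) = 1" "u \<bullet>c u = of_real ((1 / d)\<^sup>2)"
    by (rule normalize_vec[OF u u0])
  have e: "e = of_real ((1 / d)\<^sup>2)" using ue d(3) by (metis complex_cnj_cnj complex_cnj_complex_of_real)
  show thesis
  proof (rule that[of "of_real d \<cdot>\<^sub>v u" w "1 / d"])
    show "M *\<^sub>v w = of_real (1 / d) \<cdot>\<^sub>v (of_real d \<cdot>\<^sub>v u)"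
      using d(1) by (simp add: smult_smult_assoc u_def)
    show "mat_adjoint M *\<^sub>v (of_real d \<cdot>\<^sub>v u) = of_real (1 / d) \<cdot>\<^sub>v w"
      unfolding mult_mat_vec[OF M' u] M'u e using d(1)
      by (simp add: smult_smult_assoc power2_eq_square)
  qed (use u w d in auto)
qed

definition real_diag :: "nat \<Rightarrow> (nat \<Rightarrow> real) \<Rightarrow> complex mat" where
  "real_diag n s = mat n n (\<lambda>(i, j). if i = j then of_real (s i) else 0)"

lemma real_diag_carrier [simp]: "real_diag n s \<in> carrier_mat n n"
  by (simp add: real_diag_def)

lemma dim_real_diag [simp]: "dim_row (real_diag n s) = n" "dim_col (real_diag n s) = n"
  by (simp_all add: real_diag_def)

text \<open>Used for \<open>M\<close> and, with the two bases exchanged, for its adjoint; this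
  clears the first column and the first row outside the corner.\<close>

lemma first_col_conjugated:
  fixes A :: "complex mat"
  assumes A: "A \<in> carrier_mat n n" and U: "unitary_mat n U" and V: "unitary_mat n V"
    and eq: "A *\<^sub>v col V 0 = s \<cdot>\<^sub>v col U 0" and i: "i < n"
  shows "(mat_adjoint U * A * V) $$ (i, 0) = (if i = 0 then s else 0)"
proof -
  have c: "U \<in> carrier_mat n n" "V \<in> carrier_mat n n" "mat_adjoint U \<in> carrier_mat n n"
    using U V by (auto simp: unitary_mat_def)
  have n: "0 < n" using i by simp
  have "(mat_adjoint U * A * V) $$ (i, 0) = (mat_adjoint U * (A * V)) $$ (i, 0)"
    using assoc_mult_mat[OF c(3) A c(2)] by simp
  also have "\<dots> = row (mat_adjoint U) i \<bullet> col (A * V) 0"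
    by (rule index_mult_mat(1)) (use c(1,2) i n in simp_all)
  also have "col (A * V) 0 = A *\<^sub>v col V 0" by (rule col_mult2[OF A c(2) n])
  also have "row (mat_adjoint U) i \<bullet> (A *\<^sub>v col V 0) = s * (row (mat_adjoint U) i \<bullet> col U 0)"
    unfolding eq
  proof (rule scalar_prod_smult_distrib)
    show "row (mat_adjoint U) i \<in> carrier_vec n" using c(1) by (intro carrier_vecI) simp
    show "col U 0 \<in> carrier_vec n" using c(1) by (intro carrier_vecI) simp
  qed
  also have "row (mat_adjoint U) i \<bullet> col U 0 = (mat_adjoint U * U) $$ (i, 0)"
    by (rule index_mult_mat(1)[symmetric]) (use c(1,2) i n in simp_all)
  also have "\<dots> = (if i = 0 then 1 else 0)"
    using U i n by (simp add: unitary_mat_def)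
  finally show ?thesis by simp
qed

lemma block_diag_mult:
  fixes X Y :: "complex mat"
  assumes "A \<in> carrier_mat 1 1" "B \<in> carrier_mat 1 1" "X \<in> carrier_mat n n" "Y \<in> carrier_mat n n"
  shows "four_block_mat A (0\<^sub>m 1 n) (0\<^sub>m n 1) X * four_block_mat B (0\<^sub>m 1 n) (0\<^sub>m n 1) Y
    = four_block_mat (A * B) (0\<^sub>m 1 n) (0\<^sub>m n 1) (X * Y)"
proof -
  have z: "0\<^sub>m 1 n \<in> carrier_mat 1 n" "0\<^sub>m n 1 \<in> carrier_mat n 1" by auto
  have "A * B \<in> carrier_mat 1 1" "X * Y \<in> carrier_mat n n" using assms by auto
  then show ?thesis
    using assms by (subst mult_four_block_mat[OF assms(1) z(1) z(2) assms(3) assms(2) z(1) z(2) assms(4)]) simp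
qed

lemma unitary_block:
  assumes V: "unitary_mat n V"
  shows "unitary_mat (Suc n) (four_block_mat (1\<^sub>m 1) (0\<^sub>m 1 n) (0\<^sub>m n 1) V)" (is "unitary_mat _ ?B")
    and "mat_adjoint (four_block_mat (1\<^sub>m 1) (0\<^sub>m 1 n) (0\<^sub>m n 1) V)
      = four_block_mat (1\<^sub>m 1) (0\<^sub>m 1 n) (0\<^sub>m n 1) (mat_adjoint V)"
proof -
  have c: "V \<in> carrier_mat n n" "mat_adjoint V \<in> carrier_mat n n"
    using V by (auto simp: unitary_mat_def)
  have B: "?B \<in> carrier_mat (Suc n) (Suc n)" using c(1) by (intro carrier_matI) simp_all
  show adj: "mat_adjoint ?B = four_block_mat (1\<^sub>m 1) (0\<^sub>m 1 n) (0\<^sub>m n 1) (mat_adjoint V)"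
    using c(1) by (intro eq_matI) auto
  have "mat_adjoint ?B * ?B = four_block_mat (1\<^sub>m 1) (0\<^sub>m 1 n) (0\<^sub>m n 1) (1\<^sub>m n)"
    unfolding adj
    unfolding block_diag_mult[OF one_carrier_mat one_carrier_mat c(2,1)]
    using V by (simp add: unitary_mat_def)
  also have "\<dots> = 1\<^sub>m (Suc n)" by (intro eq_matI) auto
  finally show "unitary_mat (Suc n) ?B" by (rule unitary_matI[OF B])
qed

text \<open>Induction on the dimension. In two orthonormal bases that start with a singular pair,
  \<open>M\<close> becomes block diagonal with the corner \<open>s\<close> and an \<open>n\<close>
  by \<open>n\<close> block, which the induction hypothesis decomposes.\<close>

theorem svd:
  fixes M :: "complex mat"
  assumes "M \<in> carrier_mat n n"
  shows "\<exists>V W s. unitary_mat n V \<and> unitary_mat n W \<and> (\<forall>i<n. 0 \<le> s i) \<and>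
    M = V * real_diag n s * mat_adjoint W"
  using assms
proof (induction n arbitrary: M)
  case 0
  then show ?case
    by (intro exI[of _ "1\<^sub>m 0"] exI[of _ "\<lambda>_. 0"]) (auto simp: unitary_mat_def)
next
  case (Suc n)
  note M = Suc.prems
  obtain v w s where vw: "v \<in> carrier_vec (Suc n)" "w \<in> carrier_vec (Suc n)" "v \<bullet>c v = 1" "w \<bullet>c w = 1"
    and s: "0 \<le> (s :: real)"
    and Mw: "M *\<^sub>v w = of_real s \<cdot>\<^sub>v v" and Mv: "mat_adjoint M *\<^sub>v v = of_real s \<cdot>\<^sub>v w"
    using singular_pair[OF M] by auto
  obtain V where V: "unitary_mat (Suc n) V" "col V 0 = v"
    using unit_vector_extends_to_unitary[OF vw(1,3)] by blast
  obtain W where W: "unitary_mat (Suc n) W" "col W 0 = w"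
    using unit_vector_extends_to_unitary[OF vw(2,4)] by blast
  have c: "V \<in> carrier_mat (Suc n) (Suc n)" "W \<in> carrier_mat (Suc n) (Suc n)"
    "mat_adjoint V \<in> carrier_mat (Suc n) (Suc n)" "mat_adjoint W \<in> carrier_mat (Suc n) (Suc n)"
    "mat_adjoint M \<in> carrier_mat (Suc n) (Suc n)"
    using V W M by (auto simp: unitary_mat_def)
  define N where "N = mat_adjoint V * M * W"
  have N: "N \<in> carrier_mat (Suc n) (Suc n)" using c M by (auto simp: N_def)
  have N1: "N $$ (i, 0) = (if i = 0 then of_real s else 0)" if "i < Suc n" for i
    unfolding N_def by (rule first_col_conjugated) (use V W M Mw that in auto)
  have N2: "N $$ (0, i) = (if i = 0 then of_real s else 0)" if "i < Suc n" for i
  proof -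
    have "mat_adjoint N = mat_adjoint W * mat_adjoint M * V"
      unfolding N_def
      using c M by (simp add: mat_adjoint_mult assoc_mult_mat_dim)
    then have "mat_adjoint N $$ (i, 0) = (if i = 0 then of_real s else 0)"
      using first_col_conjugated[OF c(5) W(1) V(1), of "of_real s" i] V W Mv that by simp
    then have "cnj (N $$ (0, i)) = (if i = 0 then of_real s else 0)" using N that by simp
    then show ?thesis by (metis complex_cnj_cnj complex_cnj_complex_of_real complex_cnj_zero)
  qed
  define M' where "M' = mat n n (\<lambda>(i, j). N $$ (Suc i, Suc j))"
  have M': "M' \<in> carrier_mat n n" by (simp add: M'_def)
  obtain V' W' s' where V': "unitary_mat n V'" and W': "unitary_mat n W'" and s': "\<forall>i<n. 0 \<le> s' i"
    and M'eq: "M' = V' * real_diag n s' * mat_adjoint W'"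
    using Suc.IH[OF M'] by blast
  have c': "V' \<in> carrier_mat n n" "W' \<in> carrier_mat n n" "mat_adjoint W' \<in> carrier_mat n n"
    using V' W' by (auto simp: unitary_mat_def)
  define blk where "blk X = four_block_mat (1\<^sub>m 1) (0\<^sub>m 1 n) (0\<^sub>m n 1) X" for X :: "complex mat"
  have bc: "blk X \<in> carrier_mat (Suc n) (Suc n)" if "X \<in> carrier_mat n n" for X
    using that unfolding blk_def by auto
  have blk_adj: "mat_adjoint (blk W') = blk (mat_adjoint W')"
    unfolding blk_def by (rule unitary_block(2)[OF W'])
  define t where "t i = (if i = 0 then s else s' (i - 1))" for i
  have diag: "real_diag (Suc n) t = four_block_mat (mat 1 1 (\<lambda>_. of_real s)) (0\<^sub>m 1 n) (0\<^sub>m n 1) (real_diag n s')"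
    by (intro eq_matI) (auto simp: real_diag_def t_def)
  have "N = four_block_mat (mat 1 1 (\<lambda>_. of_real s)) (0\<^sub>m 1 n) (0\<^sub>m n 1) M'"
    using N N1 N2 by (intro eq_matI) (auto simp: M'_def)
  also have "\<dots> = blk V' * real_diag (Suc n) t * blk (mat_adjoint W')"
  proof -
    have d: "V' * real_diag n s' \<in> carrier_mat n n" using c' by auto
    have o: "mat 1 1 (\<lambda>_. complex_of_real s) \<in> carrier_mat 1 1" "1\<^sub>m 1 * mat 1 1 (\<lambda>_. complex_of_real s) \<in> carrier_mat 1 1"
      by auto
    show ?thesis
      unfolding blk_def diag M'eq block_diag_mult[OF one_carrier_mat o(1) c'(1) real_diag_carrier]
        block_diag_mult[OF o(2) one_carrier_mat d c'(3)] by simp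
  qed
  finally have Neq: "N = blk V' * real_diag (Suc n) t * blk (mat_adjoint W')" .
  have "M = V * mat_adjoint V * M * (W * mat_adjoint W)"
    using V W M by (auto simp: unitary_mat_def)
  also have "\<dots> = V * N * mat_adjoint W"
    unfolding N_def using c M by (simp add: assoc_mult_mat_dim)
  also have "\<dots> = (V * blk V') * real_diag (Suc n) t * (mat_adjoint (blk W') * mat_adjoint W)"
    unfolding Neq blk_adj using c bc[OF c'(1)] bc[OF c'(3)]
    by (simp add: assoc_mult_mat_dim)
  also have "mat_adjoint (blk W') * mat_adjoint W = mat_adjoint (W * blk W')"
    using c(2) bc[OF c'(2)] by (simp add: mat_adjoint_mult)
  finally have "M = (V * blk V') * real_diag (Suc n) t * mat_adjoint (W * blk W')" .
  moreover have "unitary_mat (Suc n) (V * blk V')" "unitary_mat (Suc n) (W * blk W')"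
    using unitary_block(1)[OF V'] unitary_block(1)[OF W'] V W
    by (auto simp: blk_def intro: unitary_mat_mult)
  moreover have "\<forall>i<Suc n. 0 \<le> t i" using s s' by (auto simp: t_def)
  ultimately show ?case by blast
qed

subsection \<open>Square roots and the trace norm\<close>

lemma real_diag_mult: "real_diag n s * real_diag n t = real_diag n (\<lambda>i. s i * t i)"
  by (intro eq_matI) (auto simp: real_diag_def scalar_prod_def if_distrib[of "\<lambda>x. _ * x"] cong: if_cong)

lemma mat_adjoint_real_diag [simp]: "mat_adjoint (real_diag n s) = real_diag n s"
  by (intro eq_matI) (auto simp: real_diag_def)

lemma real_diag_cong: "(\<And>i. i < n \<Longrightarrow> s i = t i) \<Longrightarrow> real_diag n s = real_diag n t"
  by (intro eq_matI) (auto simp: real_diag_def)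

lemma unitary_mat_cancel:
  assumes W: "unitary_mat n W" and "X \<in> carrier_mat m n" "Y \<in> carrier_mat n k"
  shows "X * mat_adjoint W * (W * Y) = X * Y"
proof -
  have c: "W \<in> carrier_mat n n" using W by (simp add: unitary_mat_def)
  have "X * mat_adjoint W * (W * Y) = X * (mat_adjoint W * W) * Y"
    using c assms(2,3) by (simp add: assoc_mult_mat_dim)
  then show ?thesis using W assms(2) by (simp add: unitary_mat_def)
qed

lemma psd_real_diag:
  assumes "\<forall>i<n. 0 \<le> s i"
  shows "psd (real_diag n s)"
proof -
  have "real_diag n s = real_diag n (\<lambda>i. sqrt (s i)) * mat_adjoint (real_diag n (\<lambda>i. sqrt (s i)))"
    unfolding mat_adjoint_real_diag real_diag_mult by (rule real_diag_cong) (use assms in simp)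
  then show ?thesis using psd_gram[of "real_diag n (\<lambda>i. sqrt (s i))" n n] by simp
qed

lemma unitary_conj_diag:
  assumes V: "unitary_mat n V" and s: "\<forall>i<n. 0 \<le> s i"
  shows "V * real_diag n s * mat_adjoint V \<in> carrier_mat n n"
    and "psd (V * real_diag n s * mat_adjoint V)"
    and "V * real_diag n s * mat_adjoint V * (V * real_diag n t * mat_adjoint V)
      = V * real_diag n (\<lambda>i. s i * t i) * mat_adjoint V"
    and "mtrace (V * real_diag n s * mat_adjoint V) = of_real (\<Sum>i<n. s i)"
proof -
  have c: "V \<in> carrier_mat n n" "mat_adjoint V \<in> carrier_mat n n"
    using V by (auto simp: unitary_mat_def)
  show "V * real_diag n s * mat_adjoint V \<in> carrier_mat n n"
    using c(1) by (intro carrier_matI) simp_all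
  show "psd (V * real_diag n s * mat_adjoint V)"
    using psd_congruence[OF c(1) real_diag_carrier psd_real_diag[OF s]] by simp
  have "V * real_diag n s \<in> carrier_mat n n" "real_diag n t * mat_adjoint V \<in> carrier_mat n n"
    using c(1) by (auto intro!: carrier_matI)
  from unitary_mat_cancel[OF V this]
  show "V * real_diag n s * mat_adjoint V * (V * real_diag n t * mat_adjoint V)
      = V * real_diag n (\<lambda>i. s i * t i) * mat_adjoint V"
    using c(1) by (simp add: assoc_mult_mat_dim flip: real_diag_mult)
  have "mtrace (V * real_diag n s * mat_adjoint V) = mtrace (mat_adjoint V * (V * real_diag n s))"
    using c by (intro mtrace_comm[of _ n n]) auto
  also have "\<dots> = mtrace (mat_adjoint V * V * real_diag n s)"
    using c by (simp add: assoc_mult_mat_dim)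
  also have "\<dots> = mtrace (real_diag n s)"
    using V by (simp add: unitary_mat_def left_mult_one_mat[OF real_diag_carrier])
  also have "\<dots> = of_real (\<Sum>i<n. s i)"
    by (simp add: mtrace_def real_diag_def)
  finally show "mtrace (V * real_diag n s * mat_adjoint V) = of_real (\<Sum>i<n. s i)" .
qed

lemma svd_gram:
  assumes "unitary_mat n V" "unitary_mat n W" and M: "M = V * real_diag n s * mat_adjoint W"
  shows "M * mat_adjoint M = V * real_diag n (\<lambda>i. s i * s i) * mat_adjoint V"
    and "mat_adjoint M * M = W * real_diag n (\<lambda>i. s i * s i) * mat_adjoint W"
proof -
  have c: "V \<in> carrier_mat n n" "W \<in> carrier_mat n n" using assms by (auto simp: unitary_mat_def)
  have M': "mat_adjoint M = W * real_diag n s * mat_adjoint V"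
    unfolding M using c by (simp add: mat_adjoint_mult assoc_mult_mat_dim)
  have c1: "V * real_diag n s \<in> carrier_mat n n" "W * real_diag n s \<in> carrier_mat n n"
    "real_diag n s * mat_adjoint V \<in> carrier_mat n n" "real_diag n s * mat_adjoint W \<in> carrier_mat n n"
    using c by (auto intro!: carrier_matI)
  show "M * mat_adjoint M = V * real_diag n (\<lambda>i. s i * s i) * mat_adjoint V"
    using unitary_mat_cancel[OF assms(2) c1(1,3)] c unfolding M' unfolding M
    by (simp add: assoc_mult_mat_dim flip: real_diag_mult)
  show "mat_adjoint M * M = W * real_diag n (\<lambda>i. s i * s i) * mat_adjoint W"
    using unitary_mat_cancel[OF assms(1) c1(2,4)] c unfolding M' unfolding M
    by (simp add: assoc_mult_mat_dim flip: real_diag_mult)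
qed

text \<open>The spectral theorem follows from the singular value decomposition and uniqueness of
  roots: \<open>A\<close> and \<open>V * real_diag n s * mat_adjoint V\<close> are both positive
  with square \<open>A * A\<close>.\<close>

lemma psd_diagonalization:
  assumes A: "A \<in> carrier_mat n n" and p: "psd A"
  shows "\<exists>V s. unitary_mat n V \<and> (\<forall>i<n. 0 \<le> s i) \<and> A = V * real_diag n s * mat_adjoint V"
proof -
  obtain V W s where VW: "unitary_mat n V" "unitary_mat n W" and s: "\<forall>i<n. 0 \<le> s i"
    and eq: "A = V * real_diag n s * mat_adjoint W"
    using svd[OF A] by blast
  note u = unitary_conj_diag[OF VW(1), of s, OF s]
  have "A * A = V * real_diag n (\<lambda>i. s i * s i) * mat_adjoint V"
    using svd_gram(1)[OF VW eq] psd_hermitian[OF A p] by simp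
  then have "A * A = V * real_diag n s * mat_adjoint V * (V * real_diag n s * mat_adjoint V)"
    using u(3)[of s] by simp
  then have "A = V * real_diag n s * mat_adjoint V"
    by (rule psd_sqrt_unique[OF A u(1) p u(2)])
  with VW s show ?thesis by blast
qed

lemma psd_sqrt:
  assumes A: "A \<in> carrier_mat n n" and p: "psd A"
  shows "psd_sqrt A \<in> carrier_mat n n" "psd (psd_sqrt A)" "psd_sqrt A * psd_sqrt A = A"
    "mat_adjoint (psd_sqrt A) = psd_sqrt A"
proof -
  obtain V s where V: "unitary_mat n V" and s: "\<forall>i<n. 0 \<le> s i"
    and eq: "A = V * real_diag n s * mat_adjoint V"
    using psd_diagonalization[OF A p] by blast
  let ?B = "V * real_diag n (\<lambda>i. sqrt (s i)) * mat_adjoint V"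
  have sq: "\<forall>i<n. 0 \<le> sqrt (s i)" using s by simp
  note u = unitary_conj_diag[OF V, of "\<lambda>i. sqrt (s i)", OF sq]
  have "real_diag n (\<lambda>i. sqrt (s i) * sqrt (s i)) = real_diag n s"
    by (rule real_diag_cong) (use s in simp)
  then have "?B * ?B = A" using u(3)[of "\<lambda>i. sqrt (s i)"] eq by simp
  with u(1,2) have "psd_sqrt A = ?B" by (rule psd_sqrt_eqI)
  then show "psd_sqrt A \<in> carrier_mat n n" "psd (psd_sqrt A)" "psd_sqrt A * psd_sqrt A = A"
    using u(1,2) \<open>?B * ?B = A\<close> by auto
  then show "mat_adjoint (psd_sqrt A) = psd_sqrt A" by (intro psd_hermitian)
qed

text \<open>The left factor \<open>V\<close> cancels in the Gram matrix of the columns, whose root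
  can then be read off from \<open>W\<close>.\<close>

lemma trace_norm_svd:
  assumes V: "unitary_mat n V" and W: "unitary_mat n W" and s: "\<forall>i<n. 0 \<le> s i"
  shows "trace_norm (V * real_diag n s * mat_adjoint W) = (\<Sum>i<n. s i)"
proof -
  note u = unitary_conj_diag[OF W s]
  have "psd_sqrt (W * real_diag n (\<lambda>i. s i * s i) * mat_adjoint W) = W * real_diag n s * mat_adjoint W"
    using u by (intro psd_sqrt_eqI) auto
  then show ?thesis
    unfolding trace_norm_def svd_gram(2)[OF V W refl] using u(4) by simp
qed

text \<open>The polar decomposition of a wide matrix comes from that of the square matrix obtained by
  appending zero rows.\<close>

lemma wide_polar:
  fixes A :: "complex mat"
  assumes A: "A \<in> carrier_mat d m" and dm: "d \<le> m"
  shows "\<exists>W \<in> carrier_mat d m. W * mat_adjoint W = 1\<^sub>m d \<and> A = psd_sqrt (A * mat_adjoint A) * W"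
proof -
  define pad where "pad X = mat m m (\<lambda>(i, j). if i < d \<and> j < d then X $$ (i, j) else 0)" for X :: "complex mat"
  define A0 where "A0 = mat m m (\<lambda>(i, j). if i < d then A $$ (i, j) else 0)"
  have A0: "A0 \<in> carrier_mat m m" by (simp add: A0_def)
  obtain V W s where VW: "unitary_mat m V" "unitary_mat m W" and s: "\<forall>i<m. 0 \<le> s i"
    and eq: "A0 = V * real_diag m s * mat_adjoint W"
    using svd[OF A0] by blast
  have c: "V \<in> carrier_mat m m" "W \<in> carrier_mat m m" "mat_adjoint W \<in> carrier_mat m m" "mat_adjoint V \<in> carrier_mat m m"
    using VW by (auto simp: unitary_mat_def)
  define P where "P = V * real_diag m s * mat_adjoint V"
  define Q where "Q = V * mat_adjoint W"
  note u = unitary_conj_diag[OF VW(1), of s, OF s, folded P_def]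
  have Q: "unitary_mat m Q" unfolding Q_def by (intro unitary_mat_mult unitary_mat_adjoint VW)
  then have Qc: "Q \<in> carrier_mat m m" by (simp add: unitary_mat_def)
  have A0eq: "A0 = P * Q"
  proof -
    have "V * real_diag m s \<in> carrier_mat m m" using c(1) by (intro carrier_matI) simp_all
    from unitary_mat_cancel[OF VW(1) this c(3)] show ?thesis by (simp add: P_def Q_def eq)
  qed
  let ?r = "A * mat_adjoint A"
  have r: "?r \<in> carrier_mat d d" "psd ?r" using A psd_gram[OF A] by (auto intro!: carrier_matI)
  note sq = psd_sqrt[OF r]
  \<comment> \<open>The positive part \<open>P\<close> of the padded matrix is identified with the
    padded root of \<open>A * mat_adjoint A\<close> by uniqueness: both are positive roots of
    \<open>A0 * mat_adjoint A0\<close>.\<close>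
  have "P * P = A0 * mat_adjoint A0"
    using svd_gram(1)[OF VW eq] u(3)[of s, folded P_def] by simp
  also have "\<dots> = pad ?r"
    using A by (intro eq_matI) (auto simp: A0_def pad_def scalar_prod_def)
  also have "\<dots> = pad (psd_sqrt ?r) * pad (psd_sqrt ?r)"
  proof (rule eq_matI)
    fix i j assume "i < dim_row (pad (psd_sqrt ?r) * pad (psd_sqrt ?r))"
      "j < dim_col (pad (psd_sqrt ?r) * pad (psd_sqrt ?r))"
    then have ij: "i < m" "j < m" by (auto simp: pad_def)
    have "(pad (psd_sqrt ?r) * pad (psd_sqrt ?r)) $$ (i, j) = (\<Sum>l<m. pad (psd_sqrt ?r) $$ (i, l) * pad (psd_sqrt ?r) $$ (l, j))"
      using ij by (intro index_mult_mat_sum[of _ m m _ m]) (auto simp: pad_def)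
    also have "\<dots> = (\<Sum>l<d. pad (psd_sqrt ?r) $$ (i, l) * pad (psd_sqrt ?r) $$ (l, j))"
      using ij dm by (intro sum.mono_neutral_right) (auto simp: pad_def)
    also have "\<dots> = (if i < d \<and> j < d then (\<Sum>l<d. psd_sqrt ?r $$ (i, l) * psd_sqrt ?r $$ (l, j)) else 0)"
      using ij dm by (auto simp: pad_def)
    also have "\<dots> = (if i < d \<and> j < d then (psd_sqrt ?r * psd_sqrt ?r) $$ (i, j) else 0)"
      using index_mult_mat_sum[OF sq(1) sq(1)] by simp
    also have "\<dots> = pad ?r $$ (i, j)"
      unfolding sq(3) using ij by (simp add: pad_def)
    finally show "pad ?r $$ (i, j) = (pad (psd_sqrt ?r) * pad (psd_sqrt ?r)) $$ (i, j)" ..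
  qed (auto simp: pad_def)
  finally have PP: "P * P = pad (psd_sqrt ?r) * pad (psd_sqrt ?r)" .
  have "psd (pad (psd_sqrt ?r))"
  proof -
    \<comment> \<open>\<open>E\<close> includes the first \<open>d\<close> coordinates into all
      \<open>m\<close>, so padding is a congruence and preserves positivity.\<close>
    define E where "E = mat m d (\<lambda>(i, j). if i = j then 1 else 0 :: complex)"
    have "E \<in> carrier_mat m d" by (simp add: E_def)
    from psd_congruence[OF this sq(1,2)] have "psd (E * psd_sqrt ?r * mat_adjoint E)" .
    also have "E * psd_sqrt ?r * mat_adjoint E = pad (psd_sqrt ?r)"
    proof (rule eq_matI)
      fix i j assume "i < dim_row (pad (psd_sqrt ?r))" "j < dim_col (pad (psd_sqrt ?r))"
      then have ij: "i < m" "j < m" by (auto simp: pad_def)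
      have Eij: "(E * psd_sqrt ?r) $$ (i, l) = (if i < d then psd_sqrt ?r $$ (i, l) else 0)" if "l < d" for l
        using that ij sq(1) by (subst index_mult_mat_sum[of _ m d _ d])
          (auto simp: E_def if_distrib[of "\<lambda>x. x * _"] cong: if_cong)
      have "(E * psd_sqrt ?r * mat_adjoint E) $$ (i, j) = (\<Sum>l<d. (E * psd_sqrt ?r) $$ (i, l) * mat_adjoint E $$ (l, j))"
        using ij sq(1) by (intro index_mult_mat_sum[of _ m d _ m]) (auto simp: E_def)
      also have "\<dots> = (\<Sum>l<d. if l = j then (if i < d then psd_sqrt ?r $$ (i, l) else 0) else 0)"
        using ij Eij by (intro sum.cong) (auto simp: E_def)
      finally show "(E * psd_sqrt ?r * mat_adjoint E) $$ (i, j) = pad (psd_sqrt ?r) $$ (i, j)"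
        using ij by (auto simp: pad_def)
    qed (auto simp: pad_def E_def)
    finally show ?thesis .
  qed
  then have P: "P = pad (psd_sqrt ?r)"
    using u(1,2) PP by (intro psd_sqrt_unique[of P m]) (auto simp: pad_def)
  \<comment> \<open>Outside its upper left corner \<open>P\<close> is 0, so the first
    \<open>d\<close> rows of the unitary \<open>Q\<close> suffice, and these are
    orthonormal.\<close>
  define X where "X = mat d m (\<lambda>(i, j). Q $$ (i, j))"
  have X: "X \<in> carrier_mat d m" by (simp add: X_def)
  have "X * mat_adjoint X = 1\<^sub>m d"
  proof (rule eq_matI)
    fix i j assume "i < dim_row (1\<^sub>m d :: complex mat)" "j < dim_col (1\<^sub>m d :: complex mat)"
    then have ij: "i < d" "j < d" by auto
    have "(X * mat_adjoint X) $$ (i, j) = (Q * mat_adjoint Q) $$ (i, j)"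
      using ij dm Qc by (auto simp: X_def scalar_prod_def)
    then show "(X * mat_adjoint X) $$ (i, j) = 1\<^sub>m d $$ (i, j)"
      using Q ij dm by (auto simp: unitary_mat_def)
  qed (auto simp: X_def)
  moreover have "A = psd_sqrt ?r * X"
  proof (rule eq_matI)
    fix i j assume "i < dim_row (psd_sqrt ?r * X)" "j < dim_col (psd_sqrt ?r * X)"
    then have ij: "i < d" "j < m" using sq(1) X by auto
    have "A $$ (i, j) = (P * Q) $$ (i, j)" using ij dm unfolding A0eq[symmetric] by (simp add: A0_def)
    also have "\<dots> = (\<Sum>l<m. P $$ (i, l) * Q $$ (l, j))"
      using ij dm by (intro index_mult_mat_sum[OF u(1) Qc]) auto
    also have "\<dots> = (\<Sum>l<d. P $$ (i, l) * Q $$ (l, j))"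
      using ij dm by (intro sum.mono_neutral_right) (auto simp: P pad_def)
    also have "\<dots> = (\<Sum>l<d. psd_sqrt ?r $$ (i, l) * X $$ (l, j))"
      using ij dm by (intro sum.cong) (auto simp: P pad_def X_def)
    also have "\<dots> = (psd_sqrt ?r * X) $$ (i, j)"
      using index_mult_mat_sum[OF sq(1) X ij] by simp
    finally show "A $$ (i, j) = (psd_sqrt ?r * X) $$ (i, j)" .
  qed (use A sq(1) in \<open>auto simp: X_def\<close>)
  ultimately show ?thesis using X by blast
qed

section \<open>Fidelity as the largest overlap of matrices with given Gram matrices\<close>

lemma coisometry_unitary_mult:
  assumes U: "unitary_mat d U" and W: "W \<in> carrier_mat d m" "W * mat_adjoint W = 1\<^sub>m d"
  shows "U * W * mat_adjoint (U * W) = 1\<^sub>m d"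
proof -
  have c: "U \<in> carrier_mat d d" using U by (simp add: unitary_mat_def)
  have "U * W * mat_adjoint (U * W) = U * (W * mat_adjoint W) * mat_adjoint U"
    using c W(1) by (simp add: mat_adjoint_mult assoc_mult_mat_dim)
  also have "\<dots> = 1\<^sub>m d" unfolding W(2) using U c by (simp add: unitary_mat_def)
  finally show ?thesis .
qed

text \<open>Polar decompositions of \<open>A\<close> and \<open>B\<close> and the singular value
  decomposition of the product of the two roots turn the overlap into a sum of singular values, each
  weighted with the inner product of a row of \<open>X\<close> and a row of \<open>Y\<close>. These
  rows have length 1, so the real part of each weight is at most 1.\<close>

lemma overlap_le_fidelity:
  fixes A B :: "complex mat"
  assumes A: "A \<in> carrier_mat d m" and B: "B \<in> carrier_mat d m" and dm: "d \<le> m"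
  shows "Re (mtrace (mat_adjoint A * B))
    \<le> trace_norm (psd_sqrt (A * mat_adjoint A) * psd_sqrt (B * mat_adjoint B))"
proof -
  let ?r = "psd_sqrt (A * mat_adjoint A)" and ?t = "psd_sqrt (B * mat_adjoint B)"
  obtain W1 where W1: "W1 \<in> carrier_mat d m" "W1 * mat_adjoint W1 = 1\<^sub>m d" "A = ?r * W1"
    using wide_polar[OF A dm] by blast
  obtain W2 where W2: "W2 \<in> carrier_mat d m" "W2 * mat_adjoint W2 = 1\<^sub>m d" "B = ?t * W2"
    using wide_polar[OF B dm] by blast
  have AA: "A * mat_adjoint A \<in> carrier_mat d d" "B * mat_adjoint B \<in> carrier_mat d d"
    using A B by (auto intro!: carrier_matI)
  note r = psd_sqrt[OF AA(1) psd_gram[OF A]] and t = psd_sqrt[OF AA(2) psd_gram[OF B]]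
  have M: "?r * ?t \<in> carrier_mat d d" using r(1) t(1) by auto
  obtain V U s where VU: "unitary_mat d V" "unitary_mat d U" and s: "\<forall>i<d. 0 \<le> s i"
    and eq: "?r * ?t = V * real_diag d s * mat_adjoint U"
    using svd[OF M] by blast
  have c: "V \<in> carrier_mat d d" "U \<in> carrier_mat d d" using VU by (auto simp: unitary_mat_def)
  define X where "X = mat_adjoint U * W2"
  define Y where "Y = mat_adjoint V * W1"
  have X: "X \<in> carrier_mat d m" and Y: "Y \<in> carrier_mat d m"
    using c W1 W2 by (auto simp: X_def Y_def intro!: carrier_matI)
  have XX: "X * mat_adjoint X = 1\<^sub>m d" and YY: "Y * mat_adjoint Y = 1\<^sub>m d"
    unfolding X_def Y_def using coisometry_unitary_mult unitary_mat_adjoint VU W1 W2 by blast+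
  have unit_row: "(\<Sum>k<m. (cmod (Z $$ (i, k)))\<^sup>2) = 1"
    if "Z \<in> carrier_mat d m" "Z * mat_adjoint Z = 1\<^sub>m d" "i < d" for Z i
  proof -
    have "(Z * mat_adjoint Z) $$ (i, i) = of_real (\<Sum>k<m. (cmod (Z $$ (i, k)))\<^sup>2)"
      using that(1,3) by (subst index_mult_mat_sum[OF that(1) mat_adjoint_carrier[OF that(1)]])
        (auto simp: complex_norm_square[symmetric])
    then have "complex_of_real (\<Sum>k<m. (cmod (Z $$ (i, k)))\<^sup>2) = 1" using that by simp
    then show ?thesis by (simp only: of_real_eq_1_iff)
  qed
  have "mat_adjoint A = mat_adjoint W1 * ?r"
    using arg_cong[OF W1(3), of mat_adjoint] W1(1) r(1,4) by (simp add: mat_adjoint_mult)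
  then have "mat_adjoint A * B = mat_adjoint W1 * ?r * (?t * W2)"
    using W2(3) by (rule arg_cong2[of _ _ _ _ "(*)"])
  also have "\<dots> = mat_adjoint W1 * (?r * ?t) * W2"
    using W1(1) W2(1) r(1) t(1) by (simp add: assoc_mult_mat_dim)
  also have "\<dots> = mat_adjoint Y * (real_diag d s * X)"
    unfolding eq X_def Y_def using c W1(1) W2(1) by (simp add: mat_adjoint_mult assoc_mult_mat_dim)
  finally have "mtrace (mat_adjoint A * B) = mtrace (real_diag d s * X * mat_adjoint Y)"
    using mtrace_comm[OF mat_adjoint_carrier[OF Y] mult_carrier_mat[OF real_diag_carrier X]] by simp
  also have "\<dots> = (\<Sum>i<d. \<Sum>k<m. (real_diag d s * X) $$ (i, k) * mat_adjoint Y $$ (k, i))"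
    using X Y by (intro mtrace_mult_sum mat_adjoint_carrier) auto
  also have "\<dots> = (\<Sum>i<d. of_real (s i) * (\<Sum>k<m. X $$ (i, k) * cnj (Y $$ (i, k))))"
  proof (intro sum.cong refl)
    fix i assume "i \<in> {..<d}"
    then have i: "i < d" by simp
    have "(real_diag d s * X) $$ (i, k) = of_real (s i) * X $$ (i, k)" if "k < m" for k
      using that i X by (subst index_mult_mat_sum[OF real_diag_carrier X])
        (auto simp: real_diag_def if_distrib[of "\<lambda>x. x * _"] cong: if_cong)
    then show "(\<Sum>k<m. (real_diag d s * X) $$ (i, k) * mat_adjoint Y $$ (k, i))
      = of_real (s i) * (\<Sum>k<m. X $$ (i, k) * cnj (Y $$ (i, k)))"
      using Y i by (auto simp: sum_distrib_left intro!: sum.cong)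
  qed
  finally have "Re (mtrace (mat_adjoint A * B)) = (\<Sum>i<d. s i * Re (\<Sum>k<m. X $$ (i, k) * cnj (Y $$ (i, k))))"
    by simp
  also have "\<dots> \<le> (\<Sum>i<d. s i * 1)"
  proof (intro sum_mono mult_left_mono)
    fix i assume "i \<in> {..<d}"
    then have i: "i < d" by simp
    have "Re (\<Sum>k<m. X $$ (i, k) * cnj (Y $$ (i, k)))
      \<le> (\<Sum>k<m. ((cmod (X $$ (i, k)))\<^sup>2 + (cmod (Y $$ (i, k)))\<^sup>2) / 2)"
      unfolding Re_sum
    proof (rule sum_mono)
      fix k
      have "Re (X $$ (i, k) * cnj (Y $$ (i, k))) \<le> cmod (X $$ (i, k)) * cmod (Y $$ (i, k))"
        by (metis complex_Re_le_cmod norm_mult complex_mod_cnj)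
      also have "\<dots> \<le> ((cmod (X $$ (i, k)))\<^sup>2 + (cmod (Y $$ (i, k)))\<^sup>2) / 2"
        using sum_squares_bound[of "cmod (X $$ (i, k))" "cmod (Y $$ (i, k))"] by simp
      finally show "Re (X $$ (i, k) * cnj (Y $$ (i, k)))
        \<le> ((cmod (X $$ (i, k)))\<^sup>2 + (cmod (Y $$ (i, k)))\<^sup>2) / 2" .
    qed
    also have "\<dots> = 1"
      using unit_row[OF X XX i] unit_row[OF Y YY i]
      by (simp add: sum.distrib flip: sum_divide_distrib)
    finally show "Re (\<Sum>k<m. X $$ (i, k) * cnj (Y $$ (i, k))) \<le> 1" .
  qed (use s in auto)
  also have "\<dots> = trace_norm (?r * ?t)"
    unfolding eq using s by (subst trace_norm_svd[OF VU]) auto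
  finally show ?thesis .
qed

text \<open>The unitary freedom in a root of \<open>\<sigma>\<close> is spent on
  \<open>Q = U * mat_adjoint V\<close>. It makes the product of the two positive roots,
  \<open>V * real_diag d s * mat_adjoint U\<close>, into the positive matrix
  \<open>V * real_diag d s * mat_adjoint V\<close>, whose trace is the full trace norm.\<close>

lemma overlap_attains_fidelity:
  fixes A \<sigma> :: "complex mat"
  assumes A: "A \<in> carrier_mat d m" and dm: "d \<le> m" and \<sigma>: "\<sigma> \<in> carrier_mat d d" "psd \<sigma>"
  shows "\<exists>S \<in> carrier_mat d m. S * mat_adjoint S = \<sigma> \<and>
    mtrace (mat_adjoint A * S) = of_real (trace_norm (psd_sqrt (A * mat_adjoint A) * psd_sqrt \<sigma>))"
proof -
  let ?r = "psd_sqrt (A * mat_adjoint A)" and ?t = "psd_sqrt \<sigma>"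
  obtain W where W: "W \<in> carrier_mat d m" "W * mat_adjoint W = 1\<^sub>m d" "A = ?r * W"
    using wide_polar[OF A dm] by blast
  have AA: "A * mat_adjoint A \<in> carrier_mat d d" using A by (auto intro!: carrier_matI)
  note r = psd_sqrt[OF AA psd_gram[OF A]] and t = psd_sqrt[OF \<sigma>]
  have M: "?r * ?t \<in> carrier_mat d d" using r(1) t(1) by auto
  obtain V U s where VU: "unitary_mat d V" "unitary_mat d U" and s: "\<forall>i<d. 0 \<le> s i"
    and eq: "?r * ?t = V * real_diag d s * mat_adjoint U"
    using svd[OF M] by blast
  have c: "V \<in> carrier_mat d d" "U \<in> carrier_mat d d" using VU by (auto simp: unitary_mat_def)
  define Q where "Q = U * mat_adjoint V"
  have Q: "unitary_mat d Q" unfolding Q_def by (intro unitary_mat_mult unitary_mat_adjoint VU)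
  then have Qc: "Q \<in> carrier_mat d d" by (simp add: unitary_mat_def)
  define S where "S = ?t * (Q * W)"
  have QW: "Q * W \<in> carrier_mat d m" using Qc W(1) by auto
  have S: "S \<in> carrier_mat d m" using QW t(1) by (auto simp: S_def)
  have "S * mat_adjoint S = ?t * (Q * W * mat_adjoint (Q * W)) * ?t"
    unfolding S_def using t(1,4) Qc W(1) by (simp add: mat_adjoint_mult assoc_mult_mat_dim)
  also have "\<dots> = \<sigma>"
    unfolding coisometry_unitary_mult[OF Q W(1,2)] using t(1,3) by simp
  finally have SS: "S * mat_adjoint S = \<sigma>" .
  have "mat_adjoint A = mat_adjoint W * ?r"
    using arg_cong[OF W(3), of mat_adjoint] W(1) r(1,4) by (simp add: mat_adjoint_mult)
  then have "mat_adjoint A * S = mat_adjoint W * ?r * (?t * (Q * W))"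
    unfolding S_def by (rule arg_cong[of _ _ "\<lambda>X. X * (?t * (Q * W))"])
  also have "\<dots> = mat_adjoint W * (?r * ?t * Q * W)"
    using W(1) r(1) t(1) Qc by (simp add: assoc_mult_mat_dim)
  finally have "mtrace (mat_adjoint A * S) = mtrace (?r * ?t * Q * W * mat_adjoint W)"
    using mtrace_comm[OF mat_adjoint_carrier[OF W(1)] mult_carrier_mat[OF mult_carrier_mat[OF M Qc] W(1)]]
    by simp
  also have "?r * ?t * Q * W * mat_adjoint W = ?r * ?t * Q * (W * mat_adjoint W)"
    using W(1) r(1) Qc t(1) by (simp add: assoc_mult_mat_dim)
  also have "\<dots> = V * real_diag d s * mat_adjoint U * (U * mat_adjoint V)"
    unfolding W(2) eq using c Qc by (simp add: Q_def)
  also have "\<dots> = V * real_diag d s * mat_adjoint V"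
    using c by (intro unitary_mat_cancel[OF VU(2)]) (auto intro!: carrier_matI)
  also have "mtrace \<dots> = of_real (trace_norm (?r * ?t))"
    unfolding eq using s by (subst unitary_conj_diag(4)[OF VU(1)], simp, subst trace_norm_svd[OF VU]) auto
  finally show ?thesis using S SS by blast
qed

lemma trace_norm_nonneg:
  assumes "A \<in> carrier_mat n n"
  shows "0 \<le> trace_norm A"
proof -
  obtain V W s where "unitary_mat n V" "unitary_mat n W" "\<forall>i<n. 0 \<le> s i"
    "A = V * real_diag n s * mat_adjoint W"
    using svd[OF assms] by blast
  then show ?thesis by (auto simp: trace_norm_svd intro!: sum_nonneg)
qed

subsection \<open>Uhlmann's theorem for block diagonal states\<close>

lemma sum_lessThan_mult:
  fixes f :: "nat \<Rightarrow> 'a :: comm_monoid_add"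
  shows "(\<Sum>l<a * b. f l) = (\<Sum>x<a. \<Sum>k<b. f (x * b + k))"
proof -
  have "(\<Sum>l<a * b. f l) = (\<Sum>x<a. sum f {x * b..<x * b + b})"
    by (rule sum.nat_group[symmetric])
  also have "\<dots> = (\<Sum>x<a. \<Sum>k<b. f (x * b + k))"
  proof (rule sum.cong[OF refl])
    fix x
    show "sum f {x * b..<x * b + b} = (\<Sum>k<b. f (x * b + k))"
      using sum.shift_bounds_nat_ivl[of f 0 "x * b" b] by (simp add: add.commute atLeast0LessThan)
  qed
  finally show ?thesis .
qed

lemma mult_add_less_mult:
  fixes i c d e :: nat
  assumes "i < d" "c < e"
  shows "i * e + c < d * e"
proof -
  have "i * e + c < Suc i * e" using assms(2) by simp
  also have "Suc i * e \<le> d * e" using assms(1) by (intro mult_le_mono1) simp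
  finally show ?thesis .
qed

lemma gram_index:
  assumes "A \<in> carrier_mat n m" "B \<in> carrier_mat k m" "i < n" "j < k"
  shows "(A * mat_adjoint B) $$ (i, j) = (\<Sum>l<m. A $$ (i, l) * cnj (B $$ (j, l)))"
  using assms by (subst index_mult_mat_sum[OF assms(1) mat_adjoint_carrier[OF assms(2)]]) auto

lemma mtrace_adjoint_mult:
  assumes "A \<in> carrier_mat n m" "B \<in> carrier_mat n m"
  shows "mtrace (mat_adjoint A * B) = (\<Sum>i<n. \<Sum>l<m. cnj (A $$ (i, l)) * B $$ (i, l))"
  using assms unfolding mtrace_mult_sum[OF mat_adjoint_carrier[OF assms(1)] assms(2)]
  by (subst sum.swap) simp

text \<open>Moves the second tensor factor of the row space to the columns.\<close>

definition side_by_side :: "nat \<Rightarrow> nat \<Rightarrow> complex mat \<Rightarrow> complex mat" where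
  "side_by_side d e A = mat d (e * dim_col A) (\<lambda>(i, l). A $$ (i * e + l div dim_col A, l mod dim_col A))"

lemma side_by_side_carrier: "A \<in> carrier_mat (d * e) N \<Longrightarrow> side_by_side d e A \<in> carrier_mat d (e * N)"
  by (auto simp: side_by_side_def)

lemma side_by_side_index:
  "A \<in> carrier_mat (d * e) N \<Longrightarrow> i < d \<Longrightarrow> c < e \<Longrightarrow> k < N \<Longrightarrow>
    side_by_side d e A $$ (i, c * N + k) = A $$ (i * e + c, k)"
  by (auto simp: side_by_side_def mult_add_less_mult)

text \<open>A Gram matrix sums over the column index anyway. Once the second tensor factor is part
  of that index, the same sum traces it out.\<close>

lemma gram_side_by_side:
  assumes A: "A \<in> carrier_mat (d * e) N"
  shows "side_by_side d e A * mat_adjoint (side_by_side d e A) = partial_trace d e (A * mat_adjoint A)"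
proof (rule eq_matI)
  note A' = side_by_side_carrier[OF A]
  fix i j assume "i < dim_row (partial_trace d e (A * mat_adjoint A))"
    "j < dim_col (partial_trace d e (A * mat_adjoint A))"
  then have ij: "i < d" "j < d" by (auto simp: partial_trace_def)
  have "(side_by_side d e A * mat_adjoint (side_by_side d e A)) $$ (i, j)
      = (\<Sum>c<e. \<Sum>k<N. A $$ (i * e + c, k) * cnj (A $$ (j * e + c, k)))"
    unfolding gram_index[OF A' A' ij] sum_lessThan_mult using ij side_by_side_index[OF A] by simp
  also have "\<dots> = (\<Sum>c<e. (A * mat_adjoint A) $$ (i * e + c, j * e + c))"
    by (intro sum.cong refl gram_index[OF A A, symmetric]) (use ij in \<open>auto simp: mult_add_less_mult\<close>)
  finally show "(side_by_side d e A * mat_adjoint (side_by_side d e A)) $$ (i, j)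
      = partial_trace d e (A * mat_adjoint A) $$ (i, j)"
    using ij by (simp add: partial_trace_def)
qed (auto simp: partial_trace_def side_by_side_def)

text \<open>The columns of this matrix are those of \<open>A\<close> with the rows outside a block set to \<open>0\<close>, one copy
  for each block. Its Gram matrix is thus \<open>A * mat_adjoint A\<close> with the off-diagonal blocks removed.\<close>

definition pinch_rows :: "nat \<Rightarrow> (nat \<Rightarrow> nat) \<Rightarrow> complex mat \<Rightarrow> complex mat" where
  "pinch_rows w g A = mat (dim_row A) (w * dim_col A)
     (\<lambda>(u, l). if g u = l div dim_col A then A $$ (u, l mod dim_col A) else 0)"

lemma pinch_rows_carrier: "A \<in> carrier_mat n m \<Longrightarrow> pinch_rows w g A \<in> carrier_mat n (w * m)"
  by (auto simp: pinch_rows_def)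

text \<open>Row \<open>u\<close> lives only in the copy with number \<open>g u\<close>, so rows of
  different blocks are orthogonal. Two matrices are allowed because the formula serves both for Gram
  matrices and, at \<open>u = v\<close>, for the overlap of two pinched roots.\<close>

lemma sum_pinch_rows:
  assumes A: "A \<in> carrier_mat n m" and B: "B \<in> carrier_mat n m"
    and uv: "u < n" "v < n" and g: "g u < w"
  shows "(\<Sum>l<w * m. pinch_rows w g A $$ (u, l) * cnj (pinch_rows w g B $$ (v, l)))
    = (if g u = g v then (\<Sum>k<m. A $$ (u, k) * cnj (B $$ (v, k))) else 0)"
proof -
  have "(\<Sum>l<w * m. pinch_rows w g A $$ (u, l) * cnj (pinch_rows w g B $$ (v, l)))
    = (\<Sum>x<w. \<Sum>k<m. pinch_rows w g A $$ (u, x * m + k) * cnj (pinch_rows w g B $$ (v, x * m + k)))"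
    by (rule sum_lessThan_mult)
  also have "\<dots> = (\<Sum>x<w. if g u = x then (if g u = g v then (\<Sum>k<m. A $$ (u, k) * cnj (B $$ (v, k))) else 0) else 0)"
    using A B uv by (intro sum.cong refl) (auto simp: pinch_rows_def mult_add_less_mult)
  also have "\<dots> = (if g u = g v then (\<Sum>k<m. A $$ (u, k) * cnj (B $$ (v, k))) else 0)"
    using g by simp
  finally show ?thesis .
qed

text \<open>\<open>g\<close> is the classical value carried by an index; in the application it reads
  off \<open>X\<close>. It depends on the first tensor factor alone, so removing off-diagonal blocks
  commutes with the partial trace and leaves the marginal \<open>\<sigma>\<close> as it was.\<close>

lemma uhlmann_block_diagonal:
  fixes \<rho> \<sigma> :: "complex mat" and g :: "nat \<Rightarrow> nat"
  assumes \<rho>: "\<rho> \<in> carrier_mat (d * e) (d * e)" "psd \<rho>"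
    and \<sigma>: "\<sigma> \<in> carrier_mat d d" "psd \<sigma>"
    and e: "0 < e" and g: "\<And>i. i < d \<Longrightarrow> g i < w"
    and b\<rho>: "\<And>u v. u < d * e \<Longrightarrow> v < d * e \<Longrightarrow> g (u div e) \<noteq> g (v div e) \<Longrightarrow> \<rho> $$ (u, v) = 0"
    and b\<sigma>: "\<And>i j. i < d \<Longrightarrow> j < d \<Longrightarrow> g i \<noteq> g j \<Longrightarrow> \<sigma> $$ (i, j) = 0"
  shows "\<exists>\<tau> \<in> carrier_mat (d * e) (d * e). psd \<tau> \<and> partial_trace d e \<tau> = \<sigma> \<and>
    (\<forall>u<d * e. \<forall>v<d * e. g (u div e) \<noteq> g (v div e) \<longrightarrow> \<tau> $$ (u, v) = 0) \<and>
    trace_norm (psd_sqrt (partial_trace d e \<rho>) * psd_sqrt \<sigma>) \<le> trace_norm (psd_sqrt \<rho> * psd_sqrt \<tau>)"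
proof -
  define N where "N = d * e"
  define h where "h u = g (u div e)" for u
  have h: "h u < w" if "u < N" for u
    using that g by (simp add: h_def N_def less_mult_imp_div_less)
  have hi: "h (i * e + c) = g i" if "c < e" for i c using that by (simp add: h_def)
  have ie: "i * e + c < N" if "i < d" "c < e" for i c
    using that by (simp add: N_def mult_add_less_mult)
  note \<rho>N = \<rho>[folded N_def]
  define A where "A = psd_sqrt \<rho>"
  have A: "A \<in> carrier_mat N N" and AA: "A * mat_adjoint A = \<rho>"
    using psd_sqrt[OF \<rho>N] by (auto simp: A_def)
  define A' where "A' = side_by_side d e A"
  have A': "A' \<in> carrier_mat d (e * N)" and A'A': "A' * mat_adjoint A' = partial_trace d e \<rho>"
    using side_by_side_carrier[of A d e N] gram_side_by_side[of A d e N] A AA by (auto simp: A'_def N_def)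
  have A'_ix: "A' $$ (i, c * N + k) = A $$ (i * e + c, k)" if "i < d" "c < e" "k < N" for i c k
    using side_by_side_index[of A d e N] A that by (simp add: A'_def N_def)
  \<comment> \<open>The polar decomposition asks for at least as many columns as rows.\<close>
  have "d \<le> e * N" using e by (simp add: N_def)
  from overlap_attains_fidelity[OF A' this \<sigma>]
  obtain S where S: "S \<in> carrier_mat d (e * N)" "S * mat_adjoint S = \<sigma>"
    and ovl: "mtrace (mat_adjoint A' * S) = of_real (trace_norm (psd_sqrt (partial_trace d e \<rho>) * psd_sqrt \<sigma>))"
    unfolding A'A' by blast
  \<comment> \<open>The inverse of \<open>side_by_side\<close>: the second tensor factor returns
    from the columns of \<open>S\<close> to the rows.\<close>
  define B where "B = mat N N (\<lambda>(u, k). S $$ (u div e, (u mod e) * N + k))"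
  have B: "B \<in> carrier_mat N N" by (simp add: B_def)
  have B_ix: "B $$ (i * e + c, k) = S $$ (i, c * N + k)" if "i < d" "c < e" "k < N" for i c k
    using that by (simp add: B_def ie)
  define A2 where "A2 = pinch_rows w h A"
  define B2 where "B2 = pinch_rows w h B"
  have A2: "A2 \<in> carrier_mat N (w * N)" and B2: "B2 \<in> carrier_mat N (w * N)"
    using pinch_rows_carrier A B by (auto simp: A2_def B2_def)
  \<comment> \<open>Pinching \<open>A\<close> affects its Gram matrix only in entries where
    \<open>\<rho>\<close> is already 0. Thus nothing has to be known about the block structure of
    the root \<open>A\<close> itself.\<close>
  have A2A2: "A2 * mat_adjoint A2 = \<rho>"
  proof (rule eq_matI)
    fix u v assume "u < dim_row \<rho>" "v < dim_col \<rho>"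
    then have uv: "u < N" "v < N" using \<rho>N by auto
    have "(A2 * mat_adjoint A2) $$ (u, v) = (if h u = h v then (A * mat_adjoint A) $$ (u, v) else 0)"
      unfolding gram_index[OF A2 A2 uv] gram_index[OF A A uv]
      unfolding A2_def using sum_pinch_rows[where g = h and w = w, OF A A uv h[OF uv(1)]] by simp
    then show "(A2 * mat_adjoint A2) $$ (u, v) = \<rho> $$ (u, v)"
      unfolding AA using b\<rho>[folded N_def h_def, OF uv] by auto
  qed (use A2 \<rho>N in auto)
  define \<tau> where "\<tau> = B2 * mat_adjoint B2"
  have \<tau>: "\<tau> \<in> carrier_mat N N" "psd \<tau>"
    using B2 psd_gram[OF B2] by (auto simp: \<tau>_def)
  have \<tau>_ix: "\<tau> $$ (u, v) = (if h u = h v then \<Sum>k<N. B $$ (u, k) * cnj (B $$ (v, k)) else 0)"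
    if uv: "u < N" "v < N" for u v
    unfolding \<tau>_def gram_index[OF B2 B2 uv] unfolding B2_def
    by (rule sum_pinch_rows[where g = h and w = w, OF B B uv h[OF uv(1)]])
  have "partial_trace d e \<tau> = \<sigma>"
  proof (rule eq_matI)
    fix i j assume "i < dim_row \<sigma>" "j < dim_col \<sigma>"
    then have ij: "i < d" "j < d" using \<sigma> by auto
    have "partial_trace d e \<tau> $$ (i, j)
      = (\<Sum>c<e. if g i = g j then \<Sum>k<N. S $$ (i, c * N + k) * cnj (S $$ (j, c * N + k)) else 0)"
      using ij by (auto simp: partial_trace_def \<tau>_ix ie hi B_ix intro!: sum.cong)
    also have "\<dots> = (if g i = g j then \<sigma> $$ (i, j) else 0)"
      unfolding S(2)[symmetric] gram_index[OF S(1) S(1) ij] sum_lessThan_mult by simp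
    also have "\<dots> = \<sigma> $$ (i, j)" using b\<sigma>[OF ij] by auto
    finally show "partial_trace d e \<tau> $$ (i, j) = \<sigma> $$ (i, j)" .
  qed (use \<sigma> in \<open>auto simp: partial_trace_def\<close>)
  moreover have "trace_norm (psd_sqrt (partial_trace d e \<rho>) * psd_sqrt \<sigma>) \<le> trace_norm (psd_sqrt \<rho> * psd_sqrt \<tau>)"
  proof (cases "d = 0")
    case True
    note nonneg = trace_norm_nonneg[OF mult_carrier_mat[OF psd_sqrt(1)[OF \<rho>N] psd_sqrt(1)[OF \<tau>]]]
    from True show ?thesis using ovl nonneg by (simp add: mtrace_adjoint_mult[OF A' S(1)])
  next
    case False
    \<comment> \<open>A positive \<open>w\<close> gives \<open>N \<le> w * N\<close>, the shape
      required by \<open>overlap_le_fidelity\<close>.\<close>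
    then have w: "0 < w" using g[of 0] by simp
    \<comment> \<open>The overlap pairs each row of \<open>A2\<close> with the same row of
      \<open>B2\<close>, hence always within one block, so pinching does not change it.\<close>
    have "mtrace (mat_adjoint A2 * B2) = (\<Sum>u<N. cnj (\<Sum>l<w * N. A2 $$ (u, l) * cnj (B2 $$ (u, l))))"
      unfolding mtrace_adjoint_mult[OF A2 B2] by simp
    also have "\<dots> = (\<Sum>u<N. \<Sum>k<N. cnj (A $$ (u, k)) * B $$ (u, k))"
      unfolding A2_def B2_def by (intro sum.cong refl) (simp add: sum_pinch_rows[OF A B] h)
    also have "\<dots> = (\<Sum>i<d. \<Sum>c<e. \<Sum>k<N. cnj (A $$ (i * e + c, k)) * B $$ (i * e + c, k))"
      by (subst N_def) (rule sum_lessThan_mult)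
    also have "\<dots> = mtrace (mat_adjoint A' * S)"
      unfolding mtrace_adjoint_mult[OF A' S(1)] sum_lessThan_mult
      by (intro sum.cong refl) (simp add: A'_ix B_ix)
    finally have "Re (mtrace (mat_adjoint A2 * B2)) = trace_norm (psd_sqrt (partial_trace d e \<rho>) * psd_sqrt \<sigma>)"
      unfolding ovl by simp
    then show ?thesis
      using overlap_le_fidelity[OF A2 B2] w unfolding A2A2 \<tau>_def[symmetric] by simp
  qed
  moreover have "\<forall>u<d * e. \<forall>v<d * e. g (u div e) \<noteq> g (v div e) \<longrightarrow> \<tau> $$ (u, v) = 0"
    using \<tau>_ix by (simp add: N_def h_def)
  ultimately show ?thesis using \<tau> unfolding N_def by blast
qed

lemma mtrace_partial_trace:
  assumes "A \<in> carrier_mat (d * e) (d * e)"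
  shows "mtrace (partial_trace d e A) = mtrace A"
proof -
  have "mtrace A = (\<Sum>u<d * e. A $$ (u, u))" using assms by (simp add: mtrace_def)
  also have "\<dots> = (\<Sum>i<d. \<Sum>c<e. A $$ (i * e + c, i * e + c))" by (rule sum_lessThan_mult)
  finally show ?thesis by (simp add: mtrace_def partial_trace_def)
qed

subsection \<open>Classical-quantum states\<close>

lemma cq_operator_carrier: "cq_operator dX dE p r \<in> carrier_mat (dX * dE) (dX * dE)"
  by (simp add: cq_operator_def)

lemma cq_operator_index:
  assumes r: "\<And>x. x < dX \<Longrightarrow> r x \<in> carrier_mat dE dE" and ij: "i < dX * dE" "j < dX * dE"
  shows "cq_operator dX dE p r $$ (i, j)
    = (if i div dE = j div dE then of_real (p (i div dE)) * r (i div dE) $$ (i mod dE, j mod dE) else 0)"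
proof -
  have i: "i div dE < dX" "j div dE < dX"
    using ij by (simp_all add: less_mult_imp_div_less)
  have "0 < dE" using ij by (cases dE) auto
  have "cq_operator dX dE p r $$ (i, j) = (\<Sum>x<dX. if x = i div dE then
      (if i div dE = j div dE then of_real (p (i div dE)) * r (i div dE) $$ (i mod dE, j mod dE) else 0) else 0)"
    unfolding cq_operator_def index_mat(1)[OF ij] prod.case
    by (intro sum.cong refl)
      (use ij i r \<open>0 < dE\<close> in \<open>auto simp: kron_def basis_proj_def carrier_matD[OF r] mult_add_less_mult\<close>)
  then show ?thesis using i by simp
qed

lemma cq_operator_eqI:
  assumes A: "A \<in> carrier_mat (dX * dE) (dX * dE)" and r: "\<And>x. x < dX \<Longrightarrow> r x \<in> carrier_mat dE dE"
    and off: "\<And>i j. i < dX * dE \<Longrightarrow> j < dX * dE \<Longrightarrow> i div dE \<noteq> j div dE \<Longrightarrow> A $$ (i, j) = 0"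
    and on: "\<And>x a b. x < dX \<Longrightarrow> a < dE \<Longrightarrow> b < dE \<Longrightarrow>
      A $$ (x * dE + a, x * dE + b) = of_real (p x) * r x $$ (a, b)"
  shows "cq_operator dX dE p r = A"
proof (rule eq_matI)
  fix i j assume "i < dim_row A" "j < dim_col A"
  then have ij: "i < dX * dE" "j < dX * dE" using A by auto
  have dE: "0 < dE" using ij by (cases dE) auto
  show "cq_operator dX dE p r $$ (i, j) = A $$ (i, j)"
  proof (cases "i div dE = j div dE")
    case True
    have "i div dE < dX" using ij by (simp add: less_mult_imp_div_less)
    moreover have j: "i div dE * dE + j mod dE = j" unfolding True by simp
    ultimately have "A $$ (i, j) = of_real (p (i div dE)) * r (i div dE) $$ (i mod dE, j mod dE)"
      using on[of "i div dE" "i mod dE" "j mod dE"] dE by simp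
    with True show ?thesis by (simp add: cq_operator_index[OF r ij])
  next
    case False
    then show ?thesis using off[OF ij] by (simp add: cq_operator_index[OF r ij])
  qed
qed (use A in \<open>auto simp: cq_operator_def\<close>)

text \<open>The quadratic form of a block diagonal matrix splits over the blocks.\<close>

lemma psd_cq_operator:
  assumes "cq_ensemble dX dE p r"
  shows "psd (cq_operator dX dE p r)"
  unfolding psd_iff[OF cq_operator_carrier]
proof
  fix f
  have r: "r x \<in> carrier_mat dE dE" "psd (r x)" "0 \<le> p x" if "x < dX" for x
    using assms that by (auto simp: cq_ensemble_def normalized_state_def)
  let ?Q = "\<lambda>x. \<Sum>a<dE. \<Sum>b<dE. r x $$ (a, b) * f (x * dE + b) * cnj (f (x * dE + a))"
  have "(\<Sum>i<dX * dE. \<Sum>j<dX * dE. cq_operator dX dE p r $$ (i, j) * f j * cnj (f i))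
    = (\<Sum>x<dX. \<Sum>a<dE. \<Sum>y<dX. \<Sum>b<dE. cq_operator dX dE p r $$ (x * dE + a, y * dE + b)
        * f (y * dE + b) * cnj (f (x * dE + a)))"
    unfolding sum_lessThan_mult ..
  also have "\<dots> = (\<Sum>x<dX. \<Sum>a<dE. \<Sum>y<dX. if y = x then \<Sum>b<dE. of_real (p x) * r x $$ (a, b)
        * f (x * dE + b) * cnj (f (x * dE + a)) else 0)"
    by (intro sum.cong refl) (auto simp: cq_operator_index[OF r(1)] mult_add_less_mult)
  also have "\<dots> = (\<Sum>x<dX. of_real (p x) * ?Q x)"
    by (intro sum.cong refl) (simp add: sum_distrib_left mult.assoc)
  also have "\<dots> \<ge> 0"
  proof (rule sum_nonneg)
    fix x assume "x \<in> {..<dX}"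
    then have x: "x < dX" by simp
    have "0 \<le> complex_of_real (p x)" using r(3)[OF x] by (simp add: less_eq_complex_def)
    moreover have "0 \<le> ?Q x"
      using spec[OF r(2)[OF x, unfolded psd_iff[OF r(1)[OF x]]], of "\<lambda>a. f (x * dE + a)"] .
    ultimately show "0 \<le> of_real (p x) * ?Q x" by (rule mult_nonneg_nonneg)
  qed
  finally show "0 \<le> (\<Sum>i<dX * dE. \<Sum>j<dX * dE. cq_operator dX dE p r $$ (i, j) * f j * cnj (f i))" .
qed

lemma mtrace_cq_operator:
  assumes "cq_ensemble dX dE p r"
  shows "mtrace (cq_operator dX dE p r) = of_real (\<Sum>x<dX. p x)"
proof -
  have r: "r x \<in> carrier_mat dE dE" "mtrace (r x) = 1" if "x < dX" for x
    using assms that by (auto simp: cq_ensemble_def normalized_state_def)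
  have "mtrace (cq_operator dX dE p r) = (\<Sum>i<dX * dE. cq_operator dX dE p r $$ (i, i))"
    by (simp add: mtrace_def cq_operator_def)
  also have "\<dots> = (\<Sum>x<dX. \<Sum>a<dE. of_real (p x) * r x $$ (a, a))"
    unfolding sum_lessThan_mult
    by (intro sum.cong refl) (auto simp: cq_operator_index[OF r(1)] mult_add_less_mult)
  also have "\<dots> = (\<Sum>x<dX. of_real (p x) * mtrace (r x))"
    by (intro sum.cong refl) (use r(1) in \<open>auto simp: mtrace_def sum_distrib_left\<close>)
  also have "\<dots> = of_real (\<Sum>x<dX. p x)" using r(2) by simp
  finally show ?thesis .
qed

text \<open>Each conditional state is a diagonal block divided by its trace. A block of trace 0
  vanishes by positivity, so there any state may be inserted.\<close>

lemma block_diagonal_is_cq: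
  assumes T: "T \<in> carrier_mat (dX * dE) (dX * dE)" and p: "psd T" and dE: "0 < dE"
    and off: "\<And>i j. i < dX * dE \<Longrightarrow> j < dX * dE \<Longrightarrow> i div dE \<noteq> j div dE \<Longrightarrow> T $$ (i, j) = 0"
    and tr: "\<And>x. x < dX \<Longrightarrow> (\<Sum>a<dE. T $$ (x * dE + a, x * dE + a)) = of_real (q x)"
    and q: "\<And>x. x < dX \<Longrightarrow> 0 \<le> q x" "(\<Sum>x<dX. q x) \<le> 1"
  shows "\<exists>r. cq_ensemble dX dE q r \<and> cq_operator dX dE q r = T"
proof -
  \<comment> \<open>Compression to the block of \<open>x\<close>: the bra of \<open>x\<close> on the
    first factor, the identity on the second.\<close>
  define K where "K x = mat dE (dX * dE) (\<lambda>(a, j). if j = x * dE + a then 1 else 0 :: complex)" for x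
  define blk where "blk x = mat dE dE (\<lambda>(a, b). T $$ (x * dE + a, x * dE + b))" for x
  have blk: "blk x \<in> carrier_mat dE dE" for x by (simp add: blk_def)
  have blk_psd: "psd (blk x)" if x: "x < dX" for x
  proof -
    have K: "K x \<in> carrier_mat dE (dX * dE)" by (simp add: K_def)
    have K_ix: "K x $$ (b, l) = (if l = x * dE + b then 1 else 0)" if "b < dE" "l < dX * dE" for b l
      using that by (simp add: K_def)
    have "K x * T * mat_adjoint (K x) = blk x"
    proof (rule eq_matI)
      fix a b assume "a < dim_row (blk x)" "b < dim_col (blk x)"
      then have ab: "a < dE" "b < dE" by (auto simp: blk_def)
      have KT: "(K x * T) $$ (a, j) = T $$ (x * dE + a, j)" if "j < dX * dE" for j
      proof -
        have "(K x * T) $$ (a, j) = (\<Sum>l<dX * dE. if l = x * dE + a then T $$ (x * dE + a, j) else 0)"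
          unfolding index_mult_mat_sum[OF K T ab(1) that] using ab by (intro sum.cong) (auto simp: K_def)
        then show ?thesis using mult_add_less_mult[OF x ab(1)] by simp
      qed
      have "(K x * T * mat_adjoint (K x)) $$ (a, b) = (\<Sum>l<dX * dE. if l = x * dE + b then T $$ (x * dE + a, x * dE + b) else 0)"
        unfolding gram_index[OF mult_carrier_mat[OF K T] K ab] using ab
        by (intro sum.cong) (auto simp: KT K_ix simp del: index_mult_mat)
      then show "(K x * T * mat_adjoint (K x)) $$ (a, b) = blk x $$ (a, b)"
        using mult_add_less_mult[OF x ab(2)] ab by (simp add: blk_def)
    qed (use K in \<open>auto simp: blk_def\<close>)
    then show ?thesis using psd_congruence[OF K T p] by simp
  qed
  have blk_tr: "mtrace (blk x) = of_real (q x)" if "x < dX" for x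
    using tr[OF that] by (simp add: blk_def mtrace_def)
  \<comment> \<open>The default at weight 0 only has to be a normalized state; it exists since
    \<open>0 < dE\<close>.\<close>
  define r where "r x = (if q x = 0 then basis_proj dE 0 else of_real (1 / q x) \<cdot>\<^sub>m blk x)" for x
  have rc: "r x \<in> carrier_mat dE dE" for x by (simp add: r_def basis_proj_def blk_def)
  have q_r: "of_real (q x) * r x $$ (a, b) = blk x $$ (a, b)" if "x < dX" "a < dE" "b < dE" for x a b
  proof (cases "q x = 0")
    case True
    then have "blk x = 0\<^sub>m dE dE" using psd_trace_zero[OF blk blk_psd] blk_tr that by simp
    with True that show ?thesis by simp
  next
    case False
    then show ?thesis using that blk[of x] by (simp add: r_def)
  qed
  have "normalized_state dE (r x)" if x: "x < dX" for x
  proof (cases "q x = 0")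
    case True
    have "psd (basis_proj dE 0)"
    proof -
      have "basis_proj dE 0 = real_diag dE (\<lambda>i. if i = 0 then 1 else 0)"
        by (intro eq_matI) (auto simp: basis_proj_def real_diag_def)
      then show ?thesis using psd_real_diag[of dE "\<lambda>i. if i = 0 then 1 else 0"] by simp
    qed
    moreover have "mtrace (basis_proj dE 0) = 1" using dE by (simp add: mtrace_def basis_proj_def)
    ultimately show ?thesis using True rc[of x] by (simp add: normalized_state_def r_def)
  next
    case False
    have "psd (r x)"
      unfolding psd_iff[OF rc]
    proof
      fix f
      have "(\<Sum>i<dE. \<Sum>j<dE. r x $$ (i, j) * f j * cnj (f i))
        = of_real (1 / q x) * (\<Sum>i<dE. \<Sum>j<dE. blk x $$ (i, j) * f j * cnj (f i))"
        using blk[of x] False by (simp add: r_def sum_distrib_left mult.assoc)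
      also have "\<dots> \<ge> 0"
      proof (rule mult_nonneg_nonneg)
        show "0 \<le> complex_of_real (1 / q x)" using q(1)[OF x] by (simp add: less_eq_complex_def)
        show "0 \<le> (\<Sum>i<dE. \<Sum>j<dE. blk x $$ (i, j) * f j * cnj (f i))"
          using blk_psd[OF x] unfolding psd_iff[OF blk] by (rule spec)
      qed
      finally show "0 \<le> (\<Sum>i<dE. \<Sum>j<dE. r x $$ (i, j) * f j * cnj (f i))" .
    qed
    moreover have "mtrace (r x) = of_real (1 / q x) * mtrace (blk x)"
      using False blk[of x] by (simp add: r_def mtrace_def sum_distrib_left)
    ultimately show ?thesis using False rc[of x] blk_tr[OF x] by (simp add: normalized_state_def)
  qed
  then have "cq_ensemble dX dE q r" using q by (simp add: cq_ensemble_def)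
  moreover have "cq_operator dX dE q r = T"
    by (rule cq_operator_eqI[OF T rc off]) (auto simp: q_r blk_def)
  ultimately show ?thesis by blast
qed

subsection \<open>Replacing a subsystem by a basis state\<close>

text \<open>Cauchy-Schwarz against the all-ones vector. The factor \<open>e\<close> is the first of
  the two factors dim(C) in the guessing bound.\<close>

lemma norm_sum_squared_le:
  fixes z :: "nat \<Rightarrow> complex"
  shows "(cmod (\<Sum>j<e. z j))\<^sup>2 \<le> e * (\<Sum>j<e. (cmod (z j))\<^sup>2)"
proof -
  let ?a = "\<lambda>j. cmod (z j)"
  have "(cmod (\<Sum>j<e. z j))\<^sup>2 \<le> (\<Sum>j<e. ?a j)\<^sup>2"
    by (intro power_mono norm_sum) auto
  also have "\<dots> = (\<Sum>j<e. \<Sum>k<e. ?a j * ?a k)"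
    by (simp add: power2_eq_square sum_product)
  also have "\<dots> \<le> (\<Sum>j<e. \<Sum>k<e. ((?a j)\<^sup>2 + (?a k)\<^sup>2) / 2)"
  proof (intro sum_mono)
    fix j k show "?a j * ?a k \<le> ((?a j)\<^sup>2 + (?a k)\<^sup>2) / 2"
      using sum_squares_bound[of "?a j" "?a k"] by simp
  qed
  also have "\<dots> = e * (\<Sum>j<e. (?a j)\<^sup>2)"
    by (simp add: sum.distrib flip: sum_divide_distrib sum_distrib_left)
  finally show ?thesis .
qed

text \<open>Cauchy-Schwarz over the basis of the second factor, in terms of a square root \<open>A\<close> of \<open>\<rho>\<close>: this
  is the operator inequality \<open>\<rho> \<le> e (\<rho>\<^sub>B \<otimes> 1)\<close> with the identity expanded in basis states.\<close>

lemma trace_le_sum_basis_states: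
  fixes L \<rho> :: "complex mat"
  assumes L: "L \<in> carrier_mat m (d * e)" and \<rho>: "\<rho> \<in> carrier_mat (d * e) (d * e)" "psd \<rho>"
  defines "Lj \<equiv> \<lambda>j. mat m d (\<lambda>(k, i). L $$ (k, i * e + j))"
  shows "Re (mtrace (L * \<rho> * mat_adjoint L))
    \<le> e * (\<Sum>j<e. Re (mtrace (Lj j * partial_trace d e \<rho> * mat_adjoint (Lj j))))"
proof -
  define N where "N = d * e"
  note LN = L[folded N_def] and \<rho>N = \<rho>[folded N_def]
  define A where "A = psd_sqrt \<rho>"
  have A: "A \<in> carrier_mat N N" and AA: "A * mat_adjoint A = \<rho>"
    using psd_sqrt[OF \<rho>N] by (auto simp: A_def)
  define A' where "A' = side_by_side d e A"
  have A': "A' \<in> carrier_mat d (e * N)" and A'A': "A' * mat_adjoint A' = partial_trace d e \<rho>"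
    using side_by_side_carrier[of A d e N] gram_side_by_side[of A d e N] A AA by (auto simp: A'_def N_def)
  \<comment> \<open>\<open>Lj j\<close> is \<open>L\<close> after insertion of the basis vector
    \<open>j\<close> in the second factor.\<close>
  have Lj: "Lj j \<in> carrier_mat m d" for j by (simp add: Lj_def)
  \<comment> \<open>\<open>z k l j\<close> is the share of basis vector \<open>j\<close> in the
    entry \<open>(k, l)\<close> of \<open>L * A\<close>.\<close>
  define z where "z k l j = (\<Sum>i<d. L $$ (k, i * e + j) * A $$ (i * e + j, l))" for k l j
  have gram: "Re (mtrace (X * (Y * mat_adjoint Y) * mat_adjoint X))
      = (\<Sum>k<m. \<Sum>l<n'. (cmod ((X * Y) $$ (k, l)))\<^sup>2)"
    if "X \<in> carrier_mat m n" "Y \<in> carrier_mat n n'" for X Y :: "complex mat" and n n'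
  proof -
    have "X * (Y * mat_adjoint Y) * mat_adjoint X = (X * Y) * mat_adjoint (X * Y)"
      using that by (simp add: mat_adjoint_mult assoc_mult_mat_dim)
    then show ?thesis using mtrace_gram[of "X * Y" m n'] that by auto
  qed
  have "Re (mtrace (L * \<rho> * mat_adjoint L)) = (\<Sum>k<m. \<Sum>l<N. (cmod ((L * A) $$ (k, l)))\<^sup>2)"
    using gram[OF LN A] by (simp add: AA)
  also have "\<dots> = (\<Sum>k<m. \<Sum>l<N. (cmod (\<Sum>j<e. z k l j))\<^sup>2)"
  proof (intro sum.cong refl)
    fix k l assume "k \<in> {..<m}" "l \<in> {..<N}"
    then have "(L * A) $$ (k, l) = (\<Sum>u<d * e. L $$ (k, u) * A $$ (u, l))"
      using index_mult_mat_sum[OF LN A] by (simp add: N_def)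
    also have "\<dots> = (\<Sum>j<e. z k l j)"
      unfolding sum_lessThan_mult z_def by (rule sum.swap)
    finally show "(cmod ((L * A) $$ (k, l)))\<^sup>2 = (cmod (\<Sum>j<e. z k l j))\<^sup>2" by simp
  qed
  also have "\<dots> \<le> (\<Sum>k<m. \<Sum>l<N. e * (\<Sum>j<e. (cmod (z k l j))\<^sup>2))"
    by (intro sum_mono norm_sum_squared_le)
  also have "\<dots> = e * (\<Sum>j<e. \<Sum>k<m. \<Sum>l<N. (cmod (z k l j))\<^sup>2)"
    unfolding sum_distrib_left[symmetric]
    by (subst (2) sum.swap) (subst sum.swap, rule refl)
  also have "\<dots> \<le> e * (\<Sum>j<e. Re (mtrace (Lj j * partial_trace d e \<rho> * mat_adjoint (Lj j))))"
  proof (intro mult_left_mono sum_mono)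
    fix j assume "j \<in> {..<e}"
    then have j: "j < e" by simp
    have "(\<Sum>k<m. \<Sum>l<N. (cmod (z k l j))\<^sup>2)
      = (\<Sum>k<m. \<Sum>l<N. (cmod ((Lj j * A') $$ (k, j * N + l)))\<^sup>2)"
    proof (intro sum.cong refl)
      fix k l assume kl: "k \<in> {..<m}" "l \<in> {..<N}"
      have "(Lj j * A') $$ (k, j * N + l) = (\<Sum>i<d. Lj j $$ (k, i) * A' $$ (i, j * N + l))"
        using kl j by (intro index_mult_mat_sum[OF Lj A']) (auto simp: mult_add_less_mult)
      also have "\<dots> = z k l j"
        unfolding z_def using kl j
        using side_by_side_index[of A d e N] A by (intro sum.cong refl) (simp add: Lj_def A'_def N_def)
      finally show "(cmod (z k l j))\<^sup>2 = (cmod ((Lj j * A') $$ (k, j * N + l)))\<^sup>2" by simp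
    qed
    \<comment> \<open>The entries counted so far are the part \<open>c = j\<close> of the Frobenius
      norm of \<open>Lj j * A'\<close>; the other parts are nonnegative.\<close>
    also have "\<dots> \<le> (\<Sum>k<m. \<Sum>c<e. \<Sum>l<N. (cmod ((Lj j * A') $$ (k, c * N + l)))\<^sup>2)"
      by (intro sum_mono member_le_sum[of j "{..<e}" "\<lambda>c. \<Sum>l<N. (cmod ((Lj j * A') $$ (_, c * N + l)))\<^sup>2"])
        (use j in \<open>auto intro: sum_nonneg\<close>)
    also have "\<dots> = (\<Sum>k<m. \<Sum>l<e * N. (cmod ((Lj j * A') $$ (k, l)))\<^sup>2)"
      unfolding sum_lessThan_mult ..
    also have "\<dots> = Re (mtrace (Lj j * partial_trace d e \<rho> * mat_adjoint (Lj j)))"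
      using gram[OF Lj A'] by (simp add: A'A')
    finally show "(\<Sum>k<m. \<Sum>l<N. (cmod (z k l j))\<^sup>2)
      \<le> Re (mtrace (Lj j * partial_trace d e \<rho> * mat_adjoint (Lj j)))" .
  qed simp
  finally show ?thesis .
qed

subsection \<open>Circuits\<close>

text \<open>With the outcomes fixed, the gates and projections multiply to a single operator. This
  reduces a circuit to one matrix per outcome list, to which
  \<open>trace_le_sum_basis_states\<close> applies.\<close>

lemma run_kraus:
  "\<exists>K \<in> carrier_mat (2 ^ n) (2 ^ n). \<forall>\<sigma> \<in> carrier_mat (2 ^ n) (2 ^ n).
    run n is w \<sigma> = K * \<sigma> * mat_adjoint K"
proof -
  have lift: "lift_gate n U qs \<in> carrier_mat (2 ^ n) (2 ^ n)" for U qs by (simp add: lift_gate_def)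
  have proj: "wire_proj n q b \<in> carrier_mat (2 ^ n) (2 ^ n)" for q b by (simp add: wire_proj_def)
  have proj_adj: "mat_adjoint (wire_proj n q b) = wire_proj n q b" for q b
    by (intro eq_matI) (auto simp: wire_proj_def)
  have step: "\<exists>K \<in> carrier_mat (2 ^ n) (2 ^ n). \<forall>\<sigma> \<in> carrier_mat (2 ^ n) (2 ^ n).
      run n is' w' (X * \<sigma> * mat_adjoint X) = K * \<sigma> * mat_adjoint K"
    if X: "X \<in> carrier_mat (2 ^ n) (2 ^ n)" and IH: "\<exists>K \<in> carrier_mat (2 ^ n) (2 ^ n). \<forall>\<sigma> \<in> carrier_mat (2 ^ n) (2 ^ n).
      run n is' w' \<sigma> = K * \<sigma> * mat_adjoint K" for X is' w'
  proof -
    obtain K where K: "K \<in> carrier_mat (2 ^ n) (2 ^ n)"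
      "\<And>\<sigma>. \<sigma> \<in> carrier_mat (2 ^ n) (2 ^ n) \<Longrightarrow> run n is' w' \<sigma> = K * \<sigma> * mat_adjoint K"
      using IH by blast
    show ?thesis
    proof (intro bexI ballI)
      fix \<sigma> :: "complex mat" assume \<sigma>: "\<sigma> \<in> carrier_mat (2 ^ n) (2 ^ n)"
      have "X * \<sigma> * mat_adjoint X \<in> carrier_mat (2 ^ n) (2 ^ n)"
        using X \<sigma> by (intro mult_carrier_mat mat_adjoint_carrier)
      from K(2)[OF this] show "run n is' w' (X * \<sigma> * mat_adjoint X) = (K * X) * \<sigma> * mat_adjoint (K * X)"
        using X \<sigma> K(1) by (simp add: mat_adjoint_mult assoc_mult_mat_dim)
    qed (use K X in auto)
  qed
  \<comment> \<open>Covers outcome lists that are too short or too long, for which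
    \<open>run\<close> returns 0.\<close>
  have zero: "\<exists>K \<in> carrier_mat (2 ^ n) (2 ^ n). \<forall>\<sigma> \<in> carrier_mat (2 ^ n) (2 ^ n).
      (0\<^sub>m (2 ^ n) (2 ^ n) :: complex mat) = K * \<sigma> * mat_adjoint K"
  proof (intro bexI ballI)
    fix \<sigma> :: "complex mat" assume "\<sigma> \<in> carrier_mat (2 ^ n) (2 ^ n)"
    then show "0\<^sub>m (2 ^ n) (2 ^ n) = 0\<^sub>m (2 ^ n) (2 ^ n) * \<sigma> * mat_adjoint (0\<^sub>m (2 ^ n) (2 ^ n))"
      by (intro eq_matI) (auto simp: scalar_prod_def)
  qed auto
  show ?thesis
  proof (induction "is" arbitrary: w)
    case Nil
    show ?case
    proof (cases w)
      case Nil
      show ?thesis unfolding Nil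
        by (intro bexI[of _ "1\<^sub>m (2 ^ n)"] ballI) auto
    qed (use zero in simp)
  next
    case (Cons a "is")
    show ?case
    proof (cases a)
      case (Gate U qs)
      show ?thesis unfolding Gate run.simps by (rule step[OF lift Cons.IH])
    next
      case (Measure q)
      show ?thesis
      proof (cases w)
        case (Cons b w')
        show ?thesis
          using step[OF proj[of q b] Cons.IH[of w']] unfolding Measure Cons run.simps proj_adj .
      qed (use zero Measure in simp)
    qed
  qed
qed

section \<open>Writing a basis state with NOT gates\<close>

lemma less_two_power_eqI:
  fixes k m :: nat
  assumes "k < 2 ^ n" "m < 2 ^ n" "\<And>q. q < n \<Longrightarrow> bit k q = bit m q"
  shows "k = m"
proof -
  have "take_bit n k = take_bit n m"
    by (rule bit_eqI) (use assms(3) in \<open>auto simp: bit_take_bit_iff\<close>)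
  then show ?thesis
    unfolding take_bit_nat_eq_self[OF assms(1)] take_bit_nat_eq_self[OF assms(2)] .
qed

lemma lift_not_gate:
  assumes q: "q < n" and k: "k < 2 ^ n" and m: "m < 2 ^ n"
  shows "lift_gate n not_gate [q] $$ (k, m) = (if k = flip_bit q m then 1 else 0)"
proof -
  have not_ix: "not_gate $$ (of_bool a, of_bool b) = (if a = b then 0 else 1)" for a b
    by (cases a; cases b) (simp_all add: not_gate_def mat_of_rows_list_def)
  have flip: "flip_bit q m < 2 ^ n"
  proof -
    have "take_bit n (flip_bit q m) = flip_bit q m"
      using q by (simp add: take_bit_flip_bit_eq take_bit_nat_eq_self[OF m])
    then show ?thesis by (simp add: take_bit_nat_eq_self_iff)
  qed
  have "(\<forall>p<n. p \<notin> set [q] \<longrightarrow> bit k p = bit m p) \<and> bit k q \<noteq> bit m q \<longleftrightarrow> k = flip_bit q m"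
  proof
    assume "(\<forall>p<n. p \<notin> set [q] \<longrightarrow> bit k p = bit m p) \<and> bit k q \<noteq> bit m q"
    then show "k = flip_bit q m"
      by (intro less_two_power_eqI[OF k flip]) (auto simp: bit_flip_bit_iff)
  qed (auto simp: bit_flip_bit_iff)
  then show ?thesis
    using k m by (auto simp: lift_gate_def sub_index_def not_ix)
qed

text \<open>For injective \<open>f\<close> this is an isometry between basis vectors. Loading a
  register, with or without NOT gates applied afterwards, always has this form.\<close>

definition embedding :: "nat \<Rightarrow> nat \<Rightarrow> (nat \<Rightarrow> nat) \<Rightarrow> complex mat" where
  "embedding n D f = mat n D (\<lambda>(k, i). if k = f i then 1 else 0)"

lemma embedding_carrier: "embedding n D f \<in> carrier_mat n D"
  by (simp add: embedding_def)

lemma mult_embedding_index: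
  assumes "M \<in> carrier_mat m n" "k < m" "i < D" "f i < n"
  shows "(M * embedding n D f) $$ (k, i) = M $$ (k, f i)"
proof -
  have "(M * embedding n D f) $$ (k, i) = (\<Sum>l<n. if l = f i then M $$ (k, l) else 0)"
    unfolding index_mult_mat_sum[OF assms(1) embedding_carrier assms(2,3)]
    using assms(3) by (intro sum.cong) (auto simp: embedding_def)
  then show ?thesis using assms(4) by simp
qed

lemma lift_not_gate_mult_embedding:
  assumes "q < n" "\<And>i. i < D \<Longrightarrow> f i < 2 ^ n"
  shows "lift_gate n not_gate [q] * embedding (2 ^ n) D f = embedding (2 ^ n) D (\<lambda>i. flip_bit q (f i))"
proof (rule eq_matI)
  have c: "lift_gate n not_gate [q] \<in> carrier_mat (2 ^ n) (2 ^ n)" by (simp add: lift_gate_def)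
  fix k i assume "k < dim_row (embedding (2 ^ n) D (\<lambda>i. flip_bit q (f i)))"
    "i < dim_col (embedding (2 ^ n) D (\<lambda>i. flip_bit q (f i)))"
  then have ki: "k < 2 ^ n" "i < D" by (auto simp: embedding_def)
  then show "(lift_gate n not_gate [q] * embedding (2 ^ n) D f) $$ (k, i)
      = embedding (2 ^ n) D (\<lambda>i. flip_bit q (f i)) $$ (k, i)"
    unfolding mult_embedding_index[where f = f, OF c ki assms(2)[OF ki(2)]]
    using assms by (simp add: lift_not_gate embedding_def)
qed (auto simp: embedding_def lift_gate_def)

text \<open>The \<open>c\<close> wires from \<open>a\<close> upwards start in state 0, so flipping
  those at the binary ones of \<open>j\<close> leaves the basis state \<open>j\<close> on them,
  provided that \<open>j\<close> has at most \<open>c\<close> digits.\<close>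

definition write_basis_state :: "nat \<Rightarrow> nat \<Rightarrow> nat \<Rightarrow> instr list" where
  "write_basis_state a c j = map (\<lambda>t. Gate not_gate [a + t]) (filter (bit j) [0..<c])"

text \<open>\<open>F c\<close> loads \<open>\<sigma>\<close> with the low \<open>c\<close> digits of
  \<open>j\<close> already written. The induction peels off the last NOT gate and hands it to the
  rest of the circuit, so \<open>is\<close> has to vary.\<close>

lemma run_write_basis_state:
  fixes j :: nat
  assumes "a + c \<le> n" and D: "D \<le> 2 ^ a" and \<sigma>: "\<sigma> \<in> carrier_mat D D"
  defines "F \<equiv> \<lambda>c. embedding (2 ^ n) D (\<lambda>i. i + 2 ^ a * take_bit c j)"
  shows "run n (write_basis_state a c j @ is) w (F 0 * \<sigma> * mat_adjoint (F 0))
    = run n is w (F c * \<sigma> * mat_adjoint (F c))"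
  using assms(1)
proof (induction c arbitrary: "is")
  case 0
  then show ?case by (simp add: write_basis_state_def)
next
  case (Suc c)
  show ?case
  proof (cases "bit j c")
    case False
    then have "F (Suc c) = F c" by (simp add: F_def take_bit_Suc_from_most)
    with False Suc show ?thesis by (simp add: write_basis_state_def)
  next
    case True
    let ?X = "lift_gate n not_gate [a + c]"
    have val: "i + 2 ^ a * take_bit c j < 2 ^ (a + c)" if "i < D" for i
    proof -
      have "take_bit c j * 2 ^ a + i < 2 ^ c * 2 ^ a"
        by (rule mult_add_less_mult) (use that D in \<open>auto simp: take_bit_nat_less_exp\<close>)
      then show ?thesis by (simp add: power_add ac_simps)
    qed
    have "?X * F c = embedding (2 ^ n) D (\<lambda>i. flip_bit (a + c) (i + 2 ^ a * take_bit c j))"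
      unfolding F_def
    proof (rule lift_not_gate_mult_embedding)
      fix i assume "i < D"
      have "(2 :: nat) ^ (a + c) \<le> 2 ^ n" using Suc.prems by (intro power_increasing) auto
      then show "i + 2 ^ a * take_bit c j < 2 ^ n" using val[OF \<open>i < D\<close>] by (rule less_le_trans[rotated])
    qed (use Suc.prems in simp)
    also have "\<dots> = F (Suc c)"
    proof -
      have "flip_bit (a + c) (i + 2 ^ a * take_bit c j) = i + 2 ^ a * take_bit (Suc c) j" if "i < D" for i
      proof -
        \<comment> \<open>The value lies below \<open>2 ^ (a + c)\<close>, so bit
          \<open>a + c\<close> is still 0 and flipping it adds exactly this power.\<close>
        have "take_bit (a + c) (i + 2 ^ a * take_bit c j) = i + 2 ^ a * take_bit c j"
          using val[OF that] by (simp add: take_bit_nat_eq_self_iff)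
        then have "\<not> bit (i + 2 ^ a * take_bit c j) (a + c)"
          by (metis bit_take_bit_iff less_irrefl)
        then show ?thesis
          using True by (simp add: flip_bit_eq_if set_bit_eq take_bit_Suc_from_most power_add algebra_simps)
      qed
      then show ?thesis unfolding F_def embedding_def by (intro eq_matI) auto
    qed
    finally have XF: "?X * F c = F (Suc c)" .
    have "?X * (F c * \<sigma> * mat_adjoint (F c)) * mat_adjoint ?X
      = (?X * F c) * \<sigma> * mat_adjoint (?X * F c)"
      using \<sigma> by (simp add: F_def embedding_def lift_gate_def mat_adjoint_mult assoc_mult_mat_dim)
    then have "run n (Gate not_gate [a + c] # is) w (F c * \<sigma> * mat_adjoint (F c))
      = run n is w (F (Suc c) * \<sigma> * mat_adjoint (F (Suc c)))"
      unfolding XF by simp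
    moreover have "write_basis_state a (Suc c) j @ is = write_basis_state a c j @ Gate not_gate [a + c] # is"
      using True by (simp add: write_basis_state_def)
    ultimately show ?thesis using Suc.IH[of "Gate not_gate [a + c] # is"] Suc.prems by simp
  qed
qed

section \<open>Guessing circuits that supply the register of \<open>C\<close> themselves\<close>

lemma le_two_power_num_qubits:
  assumes "0 < d"
  shows "d \<le> 2 ^ num_qubits d"
proof -
  have "real d = 2 powr (log 2 (real d))" using assms by simp
  also have "\<dots> \<le> 2 powr (real (num_qubits d))"
    unfolding num_qubits_def by (intro powr_mono) linarith+
  also have "\<dots> = real (2 ^ num_qubits d)" by (simp add: powr_realpow)
  finally show ?thesis by (simp only: of_nat_le_iff)
qed

text \<open>Since \<open>\<lceil>l\<rceil> \<le> 2 l\<close> once \<open>l \<ge> 1\<close>, and \<open>l = 0\<close> needs no qubit.\<close>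

lemma num_qubits_le_two_log:
  assumes "0 < d"
  shows "num_qubits d \<le> nat \<lfloor>2 * log 2 (real d)\<rfloor>"
proof (cases "d = 1")
  case False
  with assms have "log 2 2 \<le> log 2 (real d)" by (subst log_le_cancel_iff) auto
  then have "1 \<le> log 2 (real d)" by simp
  then have "\<lceil>log 2 (real d)\<rceil> \<le> \<lfloor>2 * log 2 (real d)\<rfloor>" by linarith
  then show ?thesis unfolding num_qubits_def by (rule nat_mono)
qed (simp add: num_qubits_def)

text \<open>The wires that \<open>C\<close> expects to hold its second register are ancillas of the
  new circuit. Only gates are put in front, so \<open>readout\<close> still selects the same
  measurements.\<close>

definition prepend_basis_state :: "nat \<Rightarrow> nat \<Rightarrow> nat \<Rightarrow> circuit \<Rightarrow> circuit" where
  "prepend_basis_state dB dC j C =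
     C\<lparr>body := write_basis_state (num_qubits dB) (num_qubits dC) j @ body C\<rparr>"

lemma num_measurements_prepend_basis_state [simp]:
  "num_measurements (prepend_basis_state dB dC j C) = num_measurements C"
  by (simp add: prepend_basis_state_def num_measurements_def write_basis_state_def filter_empty_conv)

lemma guessing_circuit_prepend_basis_state:
  assumes "not_gate \<in> G" "guessing_circuit G dX [dB, dC] C"
  shows "guessing_circuit G dX [dB] (prepend_basis_state dB dC j C)"
proof -
  have "dim_row not_gate = 2" by (simp add: not_gate_def mat_of_rows_list_def)
  then have "wf_instr G (num_wires C) c"
    if "c \<in> set (write_basis_state (num_qubits dB) (num_qubits dC) j)" for c
    using that assms by (auto simp: write_basis_state_def gate_on_def guessing_circuit_def register_wires_def)
  then show ?thesis
    using assms(2) num_measurements_prepend_basis_state[of dB dC j C]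
    by (auto simp: guessing_circuit_def prepend_basis_state_def register_wires_def)
qed

lemma circuit_size_prepend_basis_state:
  "circuit_size (prepend_basis_state dB dC j C) \<le> circuit_size C + num_qubits dC"
proof -
  have "length (filter is_Gate (write_basis_state a c j)) \<le> c" for a c
    using length_filter_le[of "bit j" "[0..<c]"] length_filter_le[of is_Gate "write_basis_state a c j"]
    by (simp add: write_basis_state_def)
  then show ?thesis by (simp add: circuit_size_def prepend_basis_state_def)
qed

text \<open>For each outcome list, the operator of the circuit composed with the encoding plays the
  role of \<open>L\<close>. Its part at basis vector \<open>j\<close> is the same operator after
  loading \<open>B\<close> alone and writing \<open>j\<close>.\<close>

lemma output_prob_le_basis_states:
  assumes C: "guessing_circuit G dX [dB, dC] C" and dB: "0 < dB" and dC: "0 < dC"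
    and \<rho>: "\<rho> \<in> carrier_mat (dB * dC) (dB * dC)" "psd \<rho>"
  shows "output_prob C [dB, dC] \<rho> x
    \<le> dC * (\<Sum>j<dC. output_prob (prepend_basis_state dB dC j C) [dB] (partial_trace dB dC \<rho>) x)"
proof -
  let ?n = "num_wires C"
  let ?a = "num_qubits dB" and ?c = "num_qubits dC"
  let ?\<rho>B = "partial_trace dB dC \<rho>"
  have n: "?a + ?c \<le> ?n" using C by (simp add: guessing_circuit_def register_wires_def)
  have \<rho>B: "?\<rho>B \<in> carrier_mat dB dB" by (simp add: partial_trace_def)
  define W where "W = {w. length w = num_measurements C \<and> horner_sum of_bool 2 (map ((!) w) (readout C)) = x}"
  define E where "E = encode_isometry ?n [dB, dC]"
  define F where "F j = embedding (2 ^ ?n) dB (\<lambda>i. i + 2 ^ ?a * take_bit ?c j)" for j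
  have E: "E \<in> carrier_mat (2 ^ ?n) (dB * dC)" by (simp add: E_def encode_isometry_def)
  have F: "F j \<in> carrier_mat (2 ^ ?n) dB" for j by (simp add: F_def embedding_carrier)
  \<comment> \<open>The encoding puts the digits of \<open>j\<close> above the \<open>?a\<close>
    digits of \<open>i\<close>, just where the NOT gates write them. No digit is cut off, as
    \<open>dC \<le> 2 ^ ?c\<close>.\<close>
  have EF: "E $$ (l, i * dC + j) = F j $$ (l, i)" if "l < 2 ^ ?n" "i < dB" "j < dC" for l i j
  proof -
    have "j < 2 ^ ?c" using le_two_power_num_qubits[OF dC] that(3) by simp
    then have "take_bit ?c j = j" by (simp add: take_bit_nat_eq_self_iff)
    then show ?thesis
      using that mult_add_less_mult[OF that(2,3)] by (simp add: E_def encode_isometry_def F_def embedding_def)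
  qed
  have run_j: "run ?n (body (prepend_basis_state dB dC j C)) w (load ?n [dB] ?\<rho>B)
      = run ?n (body C) w (F j * ?\<rho>B * mat_adjoint (F j))" for j w
  proof -
    \<comment> \<open>Loading \<open>B\<close> alone is the stage at which no digit of
      \<open>j\<close> has been written.\<close>
    have "encode_isometry ?n [dB] = embedding (2 ^ ?n) dB (\<lambda>i. i + 2 ^ ?a * take_bit 0 j)"
      by (simp add: encode_isometry_def embedding_def)
    then show ?thesis
      unfolding load_def F_def prepend_basis_state_def
      using run_write_basis_state[OF n le_two_power_num_qubits[OF dB] \<rho>B, of j "body C" w] by simp
  qed
  have bound: "Re (mtrace (run ?n (body C) w (load ?n [dB, dC] \<rho>)))
      \<le> dC * (\<Sum>j<dC. Re (mtrace (run ?n (body C) w (F j * ?\<rho>B * mat_adjoint (F j)))))" for w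
  proof -
    obtain K where K: "K \<in> carrier_mat (2 ^ ?n) (2 ^ ?n)"
      and run: "\<And>\<sigma>. \<sigma> \<in> carrier_mat (2 ^ ?n) (2 ^ ?n) \<Longrightarrow> run ?n (body C) w \<sigma> = K * \<sigma> * mat_adjoint K"
      using run_kraus[of ?n "body C" w] by blast
    have run': "run ?n (body C) w (X * \<sigma> * mat_adjoint X) = (K * X) * \<sigma> * mat_adjoint (K * X)"
      if "X \<in> carrier_mat (2 ^ ?n) m" "\<sigma> \<in> carrier_mat m m" for X \<sigma> m
    proof -
      have "X * \<sigma> * mat_adjoint X \<in> carrier_mat (2 ^ ?n) (2 ^ ?n)"
        by (rule mult_carrier_mat[OF mult_carrier_mat[OF that] mat_adjoint_carrier[OF that(1)]])
      from run[OF this] show ?thesis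
        using K that by (simp add: mat_adjoint_mult assoc_mult_mat_dim)
    qed
    have KF: "mat (2 ^ ?n) dB (\<lambda>(k, i). (K * E) $$ (k, i * dC + j)) = K * F j" if j: "j < dC" for j
    proof (rule eq_matI)
      fix k i assume "k < dim_row (K * F j)" "i < dim_col (K * F j)"
      then have ki: "k < 2 ^ ?n" "i < dB" using K F[of j] by auto
      show "mat (2 ^ ?n) dB (\<lambda>(k, i). (K * E) $$ (k, i * dC + j)) $$ (k, i) = (K * F j) $$ (k, i)"
        unfolding index_mult_mat_sum[OF K F ki] index_mat(1)[OF ki] prod.case
          index_mult_mat_sum[OF K E ki(1) mult_add_less_mult[OF ki(2) j]]
        by (intro sum.cong refl) (simp add: EF ki j)
    qed (use K F[of j] in auto)
    have "Re (mtrace (run ?n (body C) w (load ?n [dB, dC] \<rho>))) = Re (mtrace ((K * E) * \<rho> * mat_adjoint (K * E)))"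
      unfolding load_def E_def[symmetric] run'[OF E \<rho>(1)] ..
    also have "\<dots> \<le> dC * (\<Sum>j<dC. Re (mtrace ((K * F j) * ?\<rho>B * mat_adjoint (K * F j))))"
      using trace_le_sum_basis_states[OF mult_carrier_mat[OF K E] \<rho>] by (simp add: KF)
    also have "\<dots> = dC * (\<Sum>j<dC. Re (mtrace (run ?n (body C) w (F j * ?\<rho>B * mat_adjoint (F j)))))"
      unfolding run'[OF F \<rho>B] ..
    finally show ?thesis .
  qed
  have readout: "readout (prepend_basis_state dB dC j C) = readout C"
    "num_wires (prepend_basis_state dB dC j C) = ?n" for j
    by (simp_all add: prepend_basis_state_def)
  have "output_prob C [dB, dC] \<rho> x = (\<Sum>w\<in>W. Re (mtrace (run ?n (body C) w (load ?n [dB, dC] \<rho>))))"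
    by (simp add: output_prob_def W_def)
  also have "\<dots> \<le> (\<Sum>w\<in>W. dC * (\<Sum>j<dC. Re (mtrace (run ?n (body C) w (F j * ?\<rho>B * mat_adjoint (F j))))))"
    by (intro sum_mono bound)
  also have "\<dots> = dC * (\<Sum>j<dC. \<Sum>w\<in>W. Re (mtrace (run ?n (body C) w (F j * ?\<rho>B * mat_adjoint (F j)))))"
    unfolding sum_distrib_left[symmetric] by (subst sum.swap) (rule refl)
  also have "\<dots> = dC * (\<Sum>j<dC. output_prob (prepend_basis_state dB dC j C) [dB] ?\<rho>B x)"
    by (simp add: output_prob_def readout run_j W_def)
  finally show ?thesis .
qed

subsection \<open>The chain rule\<close>

text \<open>Equal traces make the second summands of the two fidelities equal. Nonnegativity of the
  smaller trace norm is what allows squaring the inequality.\<close>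

lemma purified_dist_mono:
  assumes "trace_norm (psd_sqrt \<rho>' * psd_sqrt \<sigma>') \<le> trace_norm (psd_sqrt \<rho> * psd_sqrt \<sigma>)"
    and "0 \<le> trace_norm (psd_sqrt \<rho>' * psd_sqrt \<sigma>')"
    and "mtrace \<rho>' = mtrace \<rho>" "mtrace \<sigma>' = mtrace \<sigma>"
    and "Re (mtrace \<rho>) \<le> 1" "Re (mtrace \<sigma>) \<le> 1"
  shows "purified_dist \<rho> \<sigma> \<le> purified_dist \<rho>' \<sigma>'"
proof -
  have "0 \<le> sqrt ((1 - Re (mtrace \<rho>)) * (1 - Re (mtrace \<sigma>)))"
    using assms(5,6) by simp
  then have "gen_fidelity \<rho>' \<sigma>' \<le> gen_fidelity \<rho> \<sigma>"
    unfolding gen_fidelity_def assms(3,4) using assms(1,2) by (intro power_mono) auto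
  then show ?thesis by (simp add: purified_dist_def)
qed

text \<open>Where \<open>p x = 0\<close>, the operator does not determine the conditional state and
  \<open>r' x\<close> is an arbitrary default, so the marginal condition is claimed for the other
  \<open>x\<close> only; terms of weight 0 do not contribute to the guessing probability.\<close>

lemma cq_ball_extends:
  fixes \<rho> :: "complex mat"
  assumes \<rho>: "cq_state dX (dB * dC) \<rho>" and dB: "0 < dB" and dC: "0 < dC"
    and ens: "cq_ensemble dX dB p r"
    and ball: "cq_operator dX dB p r \<in> eps_ball \<epsilon> (partial_trace (dX * dB) dC \<rho>)"
  shows "\<exists>r'. cq_ensemble dX (dB * dC) p r' \<and> cq_operator dX (dB * dC) p r' \<in> eps_ball \<epsilon> \<rho> \<and>
    (\<forall>x<dX. p x \<noteq> 0 \<longrightarrow> partial_trace dB dC (r' x) = r x)"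
proof -
  obtain p0 r0 where ens0: "cq_ensemble dX (dB * dC) p0 r0" and \<rho>_eq: "\<rho> = cq_operator dX (dB * dC) p0 r0"
    using \<rho> by (auto simp: cq_state_def)
  let ?d = "dX * dB"
  have assoc: "dX * (dB * dC) = ?d * dC" by (rule mult.assoc[symmetric])
  define \<sigma> where "\<sigma> = cq_operator dX dB p r"
  have \<rho>c: "\<rho> \<in> carrier_mat (?d * dC) (?d * dC)"
    using cq_operator_carrier[of dX "dB * dC" p0 r0] unfolding \<rho>_eq assoc .
  have \<rho>p: "psd \<rho>" unfolding \<rho>_eq by (rule psd_cq_operator[OF ens0])
  have \<rho>t: "Re (mtrace \<rho>) \<le> 1"
    unfolding \<rho>_eq mtrace_cq_operator[OF ens0] using ens0 by (simp add: cq_ensemble_def)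
  have \<sigma>c: "\<sigma> \<in> carrier_mat ?d ?d" unfolding \<sigma>_def by (rule cq_operator_carrier)
  have \<sigma>p: "psd \<sigma>" unfolding \<sigma>_def by (rule psd_cq_operator[OF ens])
  have \<sigma>t: "mtrace \<sigma> = of_real (\<Sum>x<dX. p x)" unfolding \<sigma>_def by (rule mtrace_cq_operator[OF ens])
  have r0: "r0 x \<in> carrier_mat (dB * dC) (dB * dC)" if "x < dX" for x
    using ens0 that by (simp add: cq_ensemble_def normalized_state_def)
  have r: "r x \<in> carrier_mat dB dB" "mtrace (r x) = 1" if "x < dX" for x
    using ens that by (simp_all add: cq_ensemble_def normalized_state_def)
  \<comment> \<open>Regrouping of the tensor factors: the value of \<open>X\<close> is the same
    whether an index is read as \<open>(XB)C\<close> or as \<open>X(BC)\<close>.\<close>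
  have div: "u div dC div dB = u div (dB * dC)" for u
    by (simp add: div_mult2_eq[symmetric] mult.commute)
  have \<rho>b: "\<rho> $$ (u, v) = 0" if "u < ?d * dC" "v < ?d * dC" "u div dC div dB \<noteq> v div dC div dB" for u v
    using that unfolding \<rho>_eq assoc[symmetric] div by (simp add: cq_operator_index[OF r0])
  have \<sigma>b: "\<sigma> $$ (i, j) = 0" if "i < ?d" "j < ?d" "i div dB \<noteq> j div dB" for i j
    using that unfolding \<sigma>_def by (simp add: cq_operator_index[OF r(1)])
  obtain \<tau> where \<tau>c: "\<tau> \<in> carrier_mat (?d * dC) (?d * dC)" and \<tau>p: "psd \<tau>"
    and \<tau>\<sigma>: "partial_trace ?d dC \<tau> = \<sigma>"
    and \<tau>b: "\<forall>u<?d * dC. \<forall>v<?d * dC. u div dC div dB \<noteq> v div dC div dB \<longrightarrow> \<tau> $$ (u, v) = 0"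
    and fid: "trace_norm (psd_sqrt (partial_trace ?d dC \<rho>) * psd_sqrt \<sigma>) \<le> trace_norm (psd_sqrt \<rho> * psd_sqrt \<tau>)"
    using uhlmann_block_diagonal[where g = "\<lambda>i. i div dB" and w = dX, OF \<rho>c \<rho>p \<sigma>c \<sigma>p dC _ \<rho>b \<sigma>b]
    by (auto simp: less_mult_imp_div_less)
  have \<tau>_sum: "(\<Sum>c<dC. \<tau> $$ (x * (dB * dC) + (a * dC + c), x * (dB * dC) + (b * dC + c)))
      = of_real (p x) * r x $$ (a, b)" if "x < dX" "a < dB" "b < dB" for x a b
  proof -
    have ab: "x * dB + a < ?d" "x * dB + b < ?d" using that by (simp_all add: mult_add_less_mult)
    have "(\<Sum>c<dC. \<tau> $$ (x * (dB * dC) + (a * dC + c), x * (dB * dC) + (b * dC + c)))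
      = partial_trace ?d dC \<tau> $$ (x * dB + a, x * dB + b)"
      using ab by (simp add: partial_trace_def algebra_simps)
    also have "\<dots> = of_real (p x) * r x $$ (a, b)"
      unfolding \<tau>\<sigma> \<sigma>_def using that dB by (simp add: cq_operator_index[OF r(1) ab])
    finally show ?thesis .
  qed
  \<comment> \<open>The weights of the extension are the old ones: the trace of a block of
    \<open>\<tau>\<close> equals that of the block of \<open>\<sigma>\<close>, which is
    \<open>p x\<close> because \<open>r x\<close> is normalized.\<close>
  have "\<exists>r'. cq_ensemble dX (dB * dC) p r' \<and> cq_operator dX (dB * dC) p r' = \<tau>"
  proof (rule block_diagonal_is_cq)
    show "\<tau> \<in> carrier_mat (dX * (dB * dC)) (dX * (dB * dC))" unfolding assoc by (rule \<tau>c)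
    show "\<tau> $$ (i, j) = 0"
      if "i < dX * (dB * dC)" "j < dX * (dB * dC)" "i div (dB * dC) \<noteq> j div (dB * dC)" for i j
      using \<tau>b that unfolding assoc div by blast
    show "(\<Sum>a<dB * dC. \<tau> $$ (x * (dB * dC) + a, x * (dB * dC) + a)) = of_real (p x)" if "x < dX" for x
    proof -
      have "(\<Sum>a<dB * dC. \<tau> $$ (x * (dB * dC) + a, x * (dB * dC) + a)) = (\<Sum>a<dB. of_real (p x) * r x $$ (a, a))"
        unfolding sum_lessThan_mult by (intro sum.cong refl \<tau>_sum) (use that in auto)
      also have "\<dots> = of_real (p x) * mtrace (r x)"
        using r(1)[OF that] by (simp add: mtrace_def sum_distrib_left)
      finally show ?thesis using r(2)[OF that] by simp
    qed
  qed (use \<tau>p dB dC ens in \<open>auto simp: cq_ensemble_def\<close>)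
  then obtain r' where r': "cq_ensemble dX (dB * dC) p r'" "cq_operator dX (dB * dC) p r' = \<tau>"
    by blast
  have r'c: "r' x \<in> carrier_mat (dB * dC) (dB * dC)" if "x < dX" for x
    using r'(1) that by (simp add: cq_ensemble_def normalized_state_def)
  have "partial_trace dB dC (r' x) = r x" if x: "x < dX" and px: "p x \<noteq> 0" for x
  proof (rule eq_matI)
    fix a b assume "a < dim_row (r x)" "b < dim_col (r x)"
    then have ab: "a < dB" "b < dB" using r(1)[OF x] by auto
    have "of_real (p x) * r x $$ (a, b) = (\<Sum>c<dC. of_real (p x) * r' x $$ (a * dC + c, b * dC + c))"
      unfolding \<tau>_sum[OF x ab, symmetric] r'(2)[symmetric]
      by (intro sum.cong refl) (use ab x in \<open>simp add: cq_operator_index[OF r'c] mult_add_less_mult\<close>)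
    also have "\<dots> = of_real (p x) * partial_trace dB dC (r' x) $$ (a, b)"
      using ab by (simp add: partial_trace_def sum_distrib_left)
    finally show "partial_trace dB dC (r' x) $$ (a, b) = r x $$ (a, b)" using px by simp
  qed (use r(1)[OF x] in \<open>auto simp: partial_trace_def\<close>)
  moreover have "\<tau> \<in> eps_ball \<epsilon> \<rho>"
  proof -
    have \<tau>t: "mtrace \<tau> = mtrace \<sigma>" using mtrace_partial_trace[OF \<tau>c] \<tau>\<sigma> by simp
    have \<sigma>1: "Re (mtrace \<sigma>) \<le> 1" using \<sigma>t ens by (simp add: cq_ensemble_def)
    have \<rho>B: "partial_trace ?d dC \<rho> \<in> carrier_mat ?d ?d" "psd (partial_trace ?d dC \<rho>)"
    proof -
      show c: "partial_trace ?d dC \<rho> \<in> carrier_mat ?d ?d" by (simp add: partial_trace_def)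
      note sq = psd_sqrt[OF \<rho>c \<rho>p]
      show "psd (partial_trace ?d dC \<rho>)"
        using psd_gram[OF side_by_side_carrier[OF sq(1)]] gram_side_by_side[OF sq(1)] sq(3,4) by simp
    qed
    have "purified_dist \<rho> \<tau> \<le> purified_dist (partial_trace ?d dC \<rho>) \<sigma>"
    proof (rule purified_dist_mono[OF fid])
      show "0 \<le> trace_norm (psd_sqrt (partial_trace ?d dC \<rho>) * psd_sqrt \<sigma>)"
        by (rule trace_norm_nonneg[OF mult_carrier_mat[OF psd_sqrt(1)[OF \<rho>B] psd_sqrt(1)[OF \<sigma>c \<sigma>p]]])
    qed (use mtrace_partial_trace[OF \<rho>c] \<tau>t \<rho>t \<sigma>1 in auto)
    also have "\<dots> \<le> \<epsilon>" using ball unfolding \<sigma>_def[symmetric] by (simp add: eps_ball_def)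
    finally show ?thesis
      using \<tau>c \<tau>p \<tau>t \<sigma>1 \<rho>c by (simp add: eps_ball_def substate_def)
  qed
  ultimately show ?thesis using r' by blast
qed

text \<open>Given a circuit for \<open>BC\<close>, the hypothesis is used for each of the
  \<open>dC\<close> circuits that write a fixed basis state of \<open>C\<close>; the marginals
  \<open>r x\<close> in that bound are exactly those of the extension.\<close>

lemma unp_entropy_ge_extends:
  assumes G: "not_gate \<in> G" and dB: "0 < dB" and dC: "0 < dC" and \<rho>: "cq_state dX (dB * dC) \<rho>"
    and ge: "unp_entropy_ge G \<epsilon> (s + nat \<lfloor>2 * log 2 (real dC)\<rfloor>) dX [dB] (partial_trace (dX * dB) dC \<rho>) k"
  shows "unp_entropy_ge G \<epsilon> s dX [dB, dC] \<rho> (k - 2 * log 2 (real dC))"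
proof -
  obtain p r where ens: "cq_ensemble dX dB p r"
    and ball: "cq_operator dX dB p r \<in> eps_ball \<epsilon> (partial_trace (dX * dB) dC \<rho>)"
    and guess: "\<And>C. guessing_circuit G dX [dB] C \<Longrightarrow> circuit_size C \<le> s + nat \<lfloor>2 * log 2 (real dC)\<rfloor> \<Longrightarrow>
      (\<Sum>x<dX. p x * output_prob C [dB] (r x) x) \<le> 2 powr (- k)"
    using ge by (auto simp: unp_entropy_ge_def)
  obtain r' where r': "cq_ensemble dX (dB * dC) p r'" "cq_operator dX (dB * dC) p r' \<in> eps_ball \<epsilon> \<rho>"
    and ptr: "\<And>x. x < dX \<Longrightarrow> p x \<noteq> 0 \<Longrightarrow> partial_trace dB dC (r' x) = r x"
    using cq_ball_extends[OF \<rho> dB dC ens ball] by blast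
  have "(\<Sum>x<dX. p x * output_prob C [dB, dC] (r' x) x) \<le> 2 powr (- (k - 2 * log 2 (real dC)))"
    if C: "guessing_circuit G dX [dB, dC] C" "circuit_size C \<le> s" for C
  proof -
    let ?C = "\<lambda>j. prepend_basis_state dB dC j C"
    have "(\<Sum>x<dX. p x * output_prob C [dB, dC] (r' x) x)
      \<le> (\<Sum>x<dX. p x * (dC * (\<Sum>j<dC. output_prob (?C j) [dB] (r x) x)))"
    proof (rule sum_mono)
      fix x assume "x \<in> {..<dX}"
      then have x: "x < dX" by simp
      have r'x: "r' x \<in> carrier_mat (dB * dC) (dB * dC)" "psd (r' x)"
        using r'(1) x by (simp_all add: cq_ensemble_def normalized_state_def)
      show "p x * output_prob C [dB, dC] (r' x) x \<le> p x * (dC * (\<Sum>j<dC. output_prob (?C j) [dB] (r x) x))"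
      proof (cases "p x = 0")
        case False
        have "0 \<le> p x" using ens x by (simp add: cq_ensemble_def)
        then show ?thesis
          using output_prob_le_basis_states[OF C(1) dB dC r'x] unfolding ptr[OF x False]
          by (intro mult_left_mono)
      qed simp
    qed
    also have "\<dots> = dC * (\<Sum>j<dC. \<Sum>x<dX. p x * output_prob (?C j) [dB] (r x) x)"
      by (subst sum.swap) (simp add: sum_distrib_left ac_simps)
    \<comment> \<open>The outer \<open>dC\<close> stems from the operator inequality, the sum over
      basis states supplies the second one.\<close>
    also have "\<dots> \<le> dC * (\<Sum>j<dC. 2 powr (- k))"
    proof (intro mult_left_mono sum_mono guess)
      fix j
      show "guessing_circuit G dX [dB] (?C j)" by (rule guessing_circuit_prepend_basis_state[OF G C(1)])
      show "circuit_size (?C j) \<le> s + nat \<lfloor>2 * log 2 (real dC)\<rfloor>"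
        using circuit_size_prepend_basis_state[of dB dC j C] num_qubits_le_two_log[OF dC] C(2) by linarith
    qed simp
    also have "\<dots> = (2 powr log 2 (real dC)) * (2 powr log 2 (real dC)) * 2 powr (- k)"
      using dC by simp
    also have "\<dots> = 2 powr (- (k - 2 * log 2 (real dC)))"
      by (simp only: powr_add[symmetric]) simp
    finally show ?thesis .
  qed
  then show ?thesis using r' by (auto simp: unp_entropy_ge_def)
qed

theorem mainTheorem1:
  fixes G :: "complex mat set"
  assumes "universal_gate_set G"
  shows "\<exists>c::real. c \<ge> 0 \<and>
    (\<forall>(dX::nat) (dB::nat) (dC::nat) (\<rho>::complex mat) (\<epsilon>::real) (s::nat).
       dX \<ge> 1 \<longrightarrow> dB \<ge> 1 \<longrightarrow> dC \<ge> 1 \<longrightarrow> cq_state dX (dB * dC) \<rho> \<longrightarrow> \<epsilon> \<ge> 0 \<longrightarrow>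
       (let l = log 2 (real dC) in
          unp_entropy G \<epsilon> s dX [dB, dC] \<rho>
            \<ge> unp_entropy G \<epsilon> (s + nat \<lfloor>c * l\<rfloor>) dX [dB] (partial_trace (dX * dB) dC \<rho>)
               - ereal (2 * l)))"
\<comment> \<open>The witness 2 absorbs the rounding in the number of qubits of \<open>C\<close>:
  each of them costs at most one NOT gate.\<close>
proof (intro exI[of _ 2] conjI allI impI)
  fix dX dB dC :: nat and \<rho> :: "complex mat" and \<epsilon> :: real and s :: nat
  assume d: "dB \<ge> 1" "dC \<ge> 1" and \<rho>: "cq_state dX (dB * dC) \<rho>"
  have G: "not_gate \<in> G" using assms by (simp add: universal_gate_set_def)
  define l where "l = log 2 (real dC)"
  let ?H = "unp_entropy G \<epsilon> s dX [dB, dC] \<rho>"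
  \<comment> \<open>With the finite loss on the other side, the supremum can be bounded element by
    element, and infinite entropies need no separate treatment.\<close>
  have "unp_entropy G \<epsilon> (s + nat \<lfloor>2 * l\<rfloor>) dX [dB] (partial_trace (dX * dB) dC \<rho>) \<le> ?H + ereal (2 * l)"
    unfolding unp_entropy_def[of G \<epsilon> "s + nat \<lfloor>2 * l\<rfloor>"]
  proof (rule Sup_least)
    fix z assume "z \<in> {ereal k | k. unp_entropy_ge G \<epsilon> (s + nat \<lfloor>2 * l\<rfloor>) dX [dB] (partial_trace (dX * dB) dC \<rho>) k}"
    then obtain k where z: "z = ereal k"
      and "unp_entropy_ge G \<epsilon> (s + nat \<lfloor>2 * l\<rfloor>) dX [dB] (partial_trace (dX * dB) dC \<rho>) k"
      by blast
    then have "unp_entropy_ge G \<epsilon> s dX [dB, dC] \<rho> (k - 2 * l)"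
      using unp_entropy_ge_extends[OF G _ _ \<rho>] d by (simp add: l_def)
    then have "ereal (k - 2 * l) \<le> ?H"
      unfolding unp_entropy_def by (intro Sup_upper) blast
    then have "ereal (k - 2 * l) + ereal (2 * l) \<le> ?H + ereal (2 * l)"
      by (rule add_right_mono)
    then show "z \<le> ?H + ereal (2 * l)" by (simp add: z)
  qed
  then have "unp_entropy G \<epsilon> (s + nat \<lfloor>2 * l\<rfloor>) dX [dB] (partial_trace (dX * dB) dC \<rho>) - ereal (2 * l) \<le> ?H"
    by (simp add: ereal_minus_le_iff add.commute)
  then show "let l = log 2 (real dC) in
      unp_entropy G \<epsilon> s dX [dB, dC] \<rho>
        \<ge> unp_entropy G \<epsilon> (s + nat \<lfloor>2 * l\<rfloor>) dX [dB] (partial_trace (dX * dB) dC \<rho>) - ereal (2 * l)"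
    by (simp add: Let_def l_def)
qed simp

end
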